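(* There exist full-rank lattices $\mathcal{L}_q\subseteq\mathbb{Z}^q$, one for each prime power $q\geq 5$, such that, as $q\to\infty$ through prime powers, $$\tau(\mathcal{L}_q)\geq\left(\frac{1}{2\pi e^2}+o(1)\right)\sqrt{q}\,e^{2\sqrt{q}}.$$ In particular, $\tau(\mathcal{L}_q)\geq e^{2\sqrt{q}}$ for all sufficiently large prime powers $q$.
   Context: For a nonzero Euclidean lattice $\mathcal{L}$, put $\min\mathcal{L}=\min_{0\neq x\in\mathcal{L}}\langle x,x\rangle$ (the squared minimum) and $\tau(\mathcal{L})=|\{x\in\mathcal{L}:\langle x,x\rangle=\min\mathcal{L}\}|$ (the kissing number; both signs of each minimal vector are counted). A full-rank lattice $\mathcal{L}\subseteq\mathbb{Z}^n$ is a subgroup of $\mathbb{Z}^n$ of rank $n$, with the standard Euclidean inner product. The term $o(1)$ denotes a real-valued function of $q$ tending to $0$ as $q\to\infty$ through prime powers. *)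

theory Defs
  imports Complex_Main "HOL-Number_Theory.Prime_Powers" "Jordan_Normal_Form.VS_Connect"
begin

text \<open>Elements of $\mathbb{Z}^n$ are integer vectors in \<^term>\<open>carrier_vec n\<close>, and the Euclidean inner
  product is \<^const>\<open>scalar_prod\<close>. The group \<^term>\<open>monoid_vec TYPE(int) n\<close> is $\mathbb{Z}^n$ under
  addition.\<close>

definition int_lattice :: "nat \<Rightarrow> int vec set \<Rightarrow> bool" where
  "int_lattice n L \<longleftrightarrow> subgroup L (monoid_vec TYPE(int) n)"

text \<open>Independence is over $\mathbb{Z}$. Independent subsets of $\mathbb{Z}^n$ have at most \<open>n\<close>
  elements, so the set of cardinalities is finite and contains \<open>0\<close>.\<close>

definition lattice_rank :: "nat \<Rightarrow> int vec set \<Rightarrow> nat" where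
  "lattice_rank n L = Max {card S | S. finite S \<and> S \<subseteq> L \<and>
     \<not> LinearCombinations.module.lin_dep (class_ring :: int ring) (module_vec TYPE(int) n) S}"

definition full_rank_lattice :: "nat \<Rightarrow> int vec set \<Rightarrow> bool" where
  "full_rank_lattice n L \<longleftrightarrow> int_lattice n L \<and> lattice_rank n L = n"

text \<open>Squared minimum and kissing number. They are meaningful for \<open>L \<noteq> {0\<^sub>v n}\<close>; the set counted by
  the kissing number is finite for every \<open>L \<subseteq> carrier_vec n\<close>.\<close>

definition lattice_min :: "nat \<Rightarrow> int vec set \<Rightarrow> int" where
  "lattice_min n L = (LEAST m. \<exists>x\<in>L. x \<noteq> 0\<^sub>v n \<and> m = x \<bullet> x)"

definition kissing_number :: "nat \<Rightarrow> int vec set \<Rightarrow> nat" where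
  "kissing_number n L = card {x \<in> L. x \<bullet> x = lattice_min n L}"

definition primepow_at_top :: "nat filter" where
  "primepow_at_top = inf at_top (principal {q. primepow q})"

text \<open>Sanity check: for a set of integer vectors other than $\{0\}$ and $\emptyset$, \<^const>\<open>lattice_min\<close> is an attained lower
  bound.\<close>

lemma lattice_min:
  assumes "\<exists>x\<in>L. x \<noteq> 0\<^sub>v n"
  shows "\<exists>x\<in>L. x \<noteq> 0\<^sub>v n \<and> x \<bullet> x = lattice_min n L"
    and "\<And>y. y \<in> L \<Longrightarrow> y \<noteq> 0\<^sub>v n \<Longrightarrow> lattice_min n L \<le> y \<bullet> y"
proof -
  define P where "P m \<longleftrightarrow> (\<exists>x\<in>L. x \<noteq> 0\<^sub>v n \<and> m = x \<bullet> x)" for m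
  have nat: "m = int (nat m)" if "P m" for m
  proof -
    obtain x where "m = x \<bullet> x" using \<open>P m\<close> unfolding P_def by blast
    then have "0 \<le> m" unfolding scalar_prod_def by (simp add: sum_nonneg)
    then show ?thesis by simp
  qed
  obtain x where "x \<in> L" "x \<noteq> 0\<^sub>v n" using assms by blast
  then have "P (x \<bullet> x)" unfolding P_def by blast
  then have "P (int (nat (x \<bullet> x)))" using nat by simp
  then have k: "P (int (LEAST k. P (int k)))" by (rule LeastI)
  have le: "int (LEAST k. P (int k)) \<le> m" if m: "P m" for m
  proof -
    have "P (int (nat m))" using m nat by simp
    then have "(LEAST k. P (int k)) \<le> nat m" by (rule Least_le)
    then show ?thesis using nat[OF m] by linarith
  qed
  have eq: "lattice_min n L = int (LEAST k. P (int k))"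
    unfolding lattice_min_def P_def[symmetric] by (rule Least_equality[of P, OF k le])
  show "\<exists>x\<in>L. x \<noteq> 0\<^sub>v n \<and> x \<bullet> x = lattice_min n L"
    using k unfolding eq P_def[of "int _"] by metis
  show "lattice_min n L \<le> y \<bullet> y" if "y \<in> L" "y \<noteq> 0\<^sub>v n" for y
  proof -
    have "P (y \<bullet> y)" using that unfolding P_def by blast
    then show ?thesis unfolding eq by (rule le)
  qed
qed

end

theory Submission
  imports Defs "HOL-Number_Theory.Residues" "HOL-Algebra.Algebraic_Closure"
    "HOL-Analysis.Gamma_Function" "HOL-Real_Asymp.Real_Asymp"
begin

unbundle no vec_syntax and no inner_syntax
hide_type (open) Finite_Cartesian_Product.vec
hide_const (open) Finite_Cartesian_Product.vec

text \<open>
  Let \<open>K\<close> be a field with \<open>q\<close> elements, index the coordinates of \<open>\<int>\<^sup>q\<close> by the elements \<open>a\<close> of \<open>K\<close>,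
  and write \<open>F(u)\<close> for the product of the powers \<open>(X - a)^u(a)\<close>. Let \<open>P\<close> be a monic polynomial of
  degree \<open>k\<close> over \<open>K\<close>. Consider first the vectors \<open>x\<close> with coordinate sum \<open>0\<close> that vanish at the
  roots of \<open>P\<close> and for which the rational function \<open>F(x)\<close> is a nonzero constant modulo \<open>P\<close>. If
  \<open>x = u - v\<close> is the decomposition into positive and negative part, the last condition says that \<open>P\<close>
  divides \<open>c F(u) + d F(v)\<close> for some nonzero constants \<open>c\<close>, \<open>d\<close>. For \<open>x \<noteq> 0\<close> this combination is a
  nonzero polynomial, because \<open>F(u)\<close> and \<open>F(v)\<close> have no common root, and its degree is at most the
  sum of \<open>u\<close>. Hence this sum is at least \<open>k\<close>, and \<open>x \<bullet> x \<ge> \<Sum>\<bar>x(a)\<bar> \<ge> 2k\<close>. Weakening the two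
  vanishing conditions to congruences modulo \<open>2k\<close> gives a lattice of full rank, and it adds no
  nonzero vector of squared norm below \<open>2k\<close>, since a nonzero multiple of \<open>2k\<close> already forces the norm up
  (\<open>full_rank_kiss_lattice\<close>, \<open>kiss_lattice_norm_ge\<close>).

  The vectors of squared norm \<open>2k\<close> that are counted are the differences of the indicators of two
  disjoint \<open>k\<close>-sets \<open>A\<close>, \<open>B\<close>. For every constant \<open>c\<close> other than \<open>0\<close> and \<open>1\<close> the polynomial
  \<open>P = c F(A) + (1 - c) F(B)\<close> is monic of degree \<open>k\<close>, and the difference lies in the lattice of this
  \<open>P\<close>. How many pairs a given \<open>P\<close> receives is out of control when \<open>k\<close> is about \<open>\<surd>q\<close>, but only
  the average matters: there are \<open>(q choose k) (q - k choose k) (q - 2)\<close> triples \<open>(A, B, c)\<close>, the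
  constant \<open>c\<close> can be recovered from \<open>P\<close>, \<open>A\<close> and \<open>B\<close>, and there are only \<open>q^k\<close> choices of \<open>P\<close>.
  So some \<open>P\<close> has kissing number at least the quotient (\<open>exists_good_modulus\<close>).

  With \<open>k = \<lfloor>\<surd>q\<rfloor>\<close> the product of the two binomial coefficients is
  \<open>q! / ((q - 2k)! k!\<^sup>2)\<close>. The falling factorial is about \<open>q^(2k) e^(-2)\<close>, Stirling's formula
  bounds \<open>k!\<^sup>2\<close> from above, and the quotient becomes asymptotically at least
  \<open>\<surd>q e^(2\<surd>q) / (2 \<pi> e\<^sup>2)\<close> (\<open>count_asymptotics\<close>).

  A field with \<open>q = p^n\<close> elements is found inside an algebraic closure of \<open>\<int>/p\<close> as the set of
  solutions of \<open>x^q = x\<close> (\<open>exists_finite_field\<close>).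
\<close>

section \<open>Full rank of integer lattices\<close>

context vec_module begin

lemma lincomb_eq_zero_iff:
  assumes "finite S" "S \<subseteq> carrier_vec n"
  shows "lincomb a S = 0\<^sub>v n \<longleftrightarrow> (\<forall>i<n. (\<Sum>x\<in>S. a x * x $ i) = 0)"
proof -
  have f: "(\<lambda>x. a x \<cdot>\<^sub>v x) \<in> S \<rightarrow> carrier_vec n" using assms by auto
  have index: "lincomb a S $ i = (\<Sum>x\<in>S. a x * x $ i)" if i: "i < n" for i
    unfolding lincomb_def finsum_index[OF i f assms(2)] using assms i by (intro sum.cong) auto
  have "lincomb a S \<in> carrier_vec n" unfolding lincomb_def using finsum_closed[OF f] .
  then show ?thesis using index by (auto intro!: eq_vecI)
qed

lemma lin_dep_iff_relation:
  assumes "finite S" "S \<subseteq> carrier_vec n"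
  shows "lin_dep S \<longleftrightarrow> (\<exists>a. (\<exists>v\<in>S. a v \<noteq> 0) \<and> (\<forall>i<n. (\<Sum>x\<in>S. a x * x $ i) = 0))"
proof
  assume "lin_dep S"
  then obtain a v where "lincomb a S = 0\<^sub>v n" "v \<in> S" "a v \<noteq> 0"
    using finite_lin_dep[OF assms(1)] assms(2) by auto
  then show "\<exists>a. (\<exists>v\<in>S. a v \<noteq> 0) \<and> (\<forall>i<n. (\<Sum>x\<in>S. a x * x $ i) = 0)"
    using lincomb_eq_zero_iff[OF assms] by blast
next
  assume "\<exists>a. (\<exists>v\<in>S. a v \<noteq> 0) \<and> (\<forall>i<n. (\<Sum>x\<in>S. a x * x $ i) = 0)"
  then obtain a v where "lincomb a S = 0\<^sub>v n" "v \<in> S" "a v \<noteq> 0"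
    using lincomb_eq_zero_iff[OF assms] by blast
  then show "lin_dep S" unfolding lin_dep_def using assms by blast
qed

end

lemma common_denominator:
  fixes a :: "'b \<Rightarrow> rat"
  assumes "finite S"
  shows "\<exists>d b. d > (0::int) \<and> (\<forall>x\<in>S. of_int d * a x = of_int (b x))"
  using assms
proof induction
  case empty
  show ?case by (intro exI[of _ 1]) auto
next
  case (insert y S)
  then obtain d b where d: "d > 0" "\<forall>x\<in>S. of_int d * a x = of_int (b x)" by blast
  obtain m e where e: "a y = of_int m / of_int e" "e > 0"
    by (metis quotient_of_unique quotient_of_denom_pos quotient_of_div surj_pair)
  have "of_int (d * e) * a x = of_int (if x = y then d * m else e * b x)" if "x \<in> insert y S" for x
    using that d(2) e by (auto simp: field_simps)
  then show ?case using d(1) e(2)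
    by (intro exI[of _ "d * e"] exI[of _ "\<lambda>x. if x = y then d * m else e * b x"]) auto
qed

text \<open>A rational relation between integer vectors becomes an integral one after multiplication by a
  common denominator, so the dimension bound of \<open>\<rat>\<^sup>n\<close> carries over to independence over
  \<open>\<int>\<close>.\<close>

lemma int_lin_indpt_card_le:
  assumes S: "finite S" "S \<subseteq> carrier_vec n"
    and indpt: "\<not> LinearCombinations.module.lin_dep (class_ring :: int ring) (module_vec TYPE(int) n) S"
  shows "card S \<le> n"
proof (rule ccontr)
  assume big: "\<not> card S \<le> n"
  interpret Z: vec_module "TYPE(int)" n .
  interpret Q: vec_space "TYPE(rat)" n .
  let ?h = "map_vec rat_of_int"
  have inj: "inj_on ?h S" by (rule inj_onI) (auto simp: Matrix.vec_eq_iff)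
  have S': "finite (?h ` S)" "?h ` S \<subseteq> carrier_vec n" using S by auto
  have "card (?h ` S) > n" using big card_image[OF inj] by simp
  then have "Q.lin_dep (?h ` S)" using Q.li_le_dim(2)[of "?h ` S"] S' Q.dim_is_n by fastforce
  then obtain a where a: "\<exists>v\<in>?h ` S. a v \<noteq> 0" "\<And>i. i < n \<Longrightarrow> (\<Sum>x\<in>?h ` S. a x * x $ i) = 0"
    using Q.lin_dep_iff_relation[OF S'] by blast
  obtain d b where d: "d > 0" "\<And>x. x \<in> S \<Longrightarrow> rat_of_int d * a (?h x) = of_int (b x)"
    using common_denominator[OF S(1), of "\<lambda>x. a (?h x)"] by blast
  have "(\<Sum>x\<in>S. b x * x $ i) = 0" if i: "i < n" for i
  proof -
    have "rat_of_int (\<Sum>x\<in>S. b x * x $ i) = (\<Sum>x\<in>S. rat_of_int d * (a (?h x) * ?h x $ i))"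
      unfolding of_int_sum using d(2) S(2) i by (intro sum.cong) (auto simp: mult.assoc[symmetric])
    also have "\<dots> = rat_of_int d * (\<Sum>x\<in>?h ` S. a x * x $ i)"
      by (simp add: sum.reindex[OF inj] sum_distrib_left)
    finally have "rat_of_int (\<Sum>x\<in>S. b x * x $ i) = 0" using a(2)[OF i] by (simp del: of_int_sum)
    then show ?thesis unfolding of_int_eq_0_iff .
  qed
  moreover have "\<exists>v\<in>S. b v \<noteq> 0"
  proof -
    obtain v where v: "v \<in> S" "a (?h v) \<noteq> 0" using a(1) by blast
    then have "rat_of_int (b v) \<noteq> 0" using d(1) d(2)[OF v(1), symmetric] by simp
    then show ?thesis using v(1) by auto
  qed
  ultimately show False using indpt Z.lin_dep_iff_relation[OF S] by blast
qed

lemma scaled_unit_vecs_lin_indpt: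
  fixes c :: "nat \<Rightarrow> int"
  assumes c: "\<And>i. i < n \<Longrightarrow> c i \<noteq> 0"
  defines "S \<equiv> (\<lambda>i. c i \<cdot>\<^sub>v unit_vec n i) ` {..<n}"
  shows "card S = n" "\<not> LinearCombinations.module.lin_dep (class_ring :: int ring) (module_vec TYPE(int) n) S"
proof -
  interpret Z: vec_module "TYPE(int)" n .
  let ?u = "\<lambda>i. c i \<cdot>\<^sub>v unit_vec n i"
  have ind: "?u i $ j = (if i = j then c i else 0)" if "i < n" "j < n" for i j
    using that by simp
  have inj: "inj_on ?u {..<n}"
    using c ind by (intro inj_onI) (metis lessThan_iff)
  then show "card S = n" unfolding S_def by (simp add: card_image)
  have S: "finite S" "S \<subseteq> carrier_vec n" unfolding S_def by auto
  have "a (?u j) = 0" if rel: "\<forall>i<n. (\<Sum>x\<in>S. a x * x $ i) = 0" and j: "j < n" for a j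
  proof -
    have "0 = (\<Sum>i<n. a (?u i) * ?u i $ j)"
      using rel j unfolding S_def by (simp add: sum.reindex[OF inj])
    also have "\<dots> = (\<Sum>i<n. if i = j then a (?u j) * c j else 0)"
      using j by (intro sum.cong) auto
    finally show ?thesis using j c by simp
  qed
  then show "\<not> LinearCombinations.module.lin_dep (class_ring :: int ring) (module_vec TYPE(int) n) S"
    using Z.lin_dep_iff_relation[OF S] unfolding S_def by blast
qed

text \<open>Multiples of the unit vectors suffice as witnesses of full rank; this is how the finite index of
  the lattices below enters.\<close>

lemma full_rank_lattice_if_scaled_unit_vecs:
  assumes L: "int_lattice n L" and unit: "\<And>i. i < n \<Longrightarrow> \<exists>c::int. c \<noteq> 0 \<and> c \<cdot>\<^sub>v unit_vec n i \<in> L"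
  shows "full_rank_lattice n L"
proof -
  have Lc: "L \<subseteq> carrier_vec n"
    using L unfolding int_lattice_def by (auto dest!: subgroup.subset simp: monoid_vec_simps)
  let ?C = "{card S | S. finite S \<and> S \<subseteq> L \<and>
     \<not> LinearCombinations.module.lin_dep (class_ring :: int ring) (module_vec TYPE(int) n) S}"
  obtain c where c: "\<And>i. i < n \<Longrightarrow> c i \<noteq> (0::int) \<and> c i \<cdot>\<^sub>v unit_vec n i \<in> L" using unit by metis
  have "n \<in> ?C"
    using scaled_unit_vecs_lin_indpt[of n c] c
    by (intro CollectI exI[of _ "(\<lambda>i. c i \<cdot>\<^sub>v unit_vec n i) ` {..<n}"]) auto
  moreover have le: "m \<le> n" if "m \<in> ?C" for m
    using that int_lin_indpt_card_le Lc by blast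
  moreover have "finite ?C" using le by (meson finite_nat_set_iff_bounded_le)
  ultimately have "lattice_rank n L = n" unfolding lattice_rank_def by (intro Max_eqI) auto
  then show ?thesis using L unfolding full_rank_lattice_def by simp
qed

section \<open>Existence of finite fields\<close>

context cring begin

lemma binomial_theorem:
  assumes x: "x \<in> carrier R" and y: "y \<in> carrier R"
  shows "(x \<oplus> y) [^] (n::nat) = (\<Oplus>i\<in>{..n}. add_pow R (n choose i) (x [^] i \<otimes> y [^] (n - i)))"
proof (induction n)
  case 0
  show ?case using x y by simp
next
  case (Suc n)
  \<comment> \<open>The terms for \<open>Suc n\<close>, with variable upper index: both halves of Pascal's rule are sums of these.\<close>
  let ?t = "\<lambda>m i. add_pow R (m choose i) (x [^] i \<otimes> y [^] (Suc n - i))"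
  have cl: "add_pow R ((m::nat)) (x [^] (i::nat) \<otimes> y [^] (j::nat)) \<in> carrier R" for m i j
    using x y by simp
  have X: "x \<otimes> (\<Oplus>i\<in>{..n}. add_pow R (n choose i) (x [^] i \<otimes> y [^] (n - i)))
      = (\<Oplus>i\<in>{..n}. add_pow R (n choose i) (x [^] Suc i \<otimes> y [^] (n - i)))"
  proof -
    have "x \<otimes> (\<Oplus>i\<in>{..n}. add_pow R (n choose i) (x [^] i \<otimes> y [^] (n - i)))
      = (\<Oplus>i\<in>{..n}. x \<otimes> (add_pow R (n choose i) (x [^] i \<otimes> y [^] (n - i))))"
      using x cl by (subst finsum_rdistr) auto
    also have "\<dots> = (\<Oplus>i\<in>{..n}. add_pow R (n choose i) (x [^] Suc i \<otimes> y [^] (n - i)))"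
      using x y by (intro finsum_cong') (auto simp: add_pow_rdistr m_ac)
    finally show ?thesis .
  qed
  have Y: "y \<otimes> (\<Oplus>i\<in>{..n}. add_pow R (n choose i) (x [^] i \<otimes> y [^] (n - i)))
      = (\<Oplus>i\<in>{..n}. ?t n i)"
  proof -
    have "y \<otimes> (\<Oplus>i\<in>{..n}. add_pow R (n choose i) (x [^] i \<otimes> y [^] (n - i)))
      = (\<Oplus>i\<in>{..n}. y \<otimes> (add_pow R (n choose i) (x [^] i \<otimes> y [^] (n - i))))"
      using y cl by (subst finsum_rdistr) auto
    also have "\<dots> = (\<Oplus>i\<in>{..n}. ?t n i)"
      using x y by (intro finsum_cong') (auto simp: add_pow_rdistr Suc_diff_le m_ac)
    finally show ?thesis .
  qed
  have "(x \<oplus> y) [^] Suc n = (x \<oplus> y) \<otimes> (x \<oplus> y) [^] n"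
    using x y nat_pow_Suc2[of "x \<oplus> y"] by blast
  also have "\<dots> = (\<Oplus>i\<in>{..n}. add_pow R (n choose i) (x [^] Suc i \<otimes> y [^] (n - i))) \<oplus> (\<Oplus>i\<in>{..n}. ?t n i)"
    unfolding Suc X[symmetric] Y[symmetric] using x y cl by (intro l_distr) auto
  also have "(\<Oplus>i\<in>{..n}. ?t n i) = (\<Oplus>i\<in>{..Suc n}. ?t n i)"
    using x y by (simp add: binomial_eq_0)
  also have "\<dots> = (\<Oplus>i\<in>{..n}. ?t n (Suc i)) \<oplus> ?t n 0"
    using cl by (subst finsum_Suc2) auto
  also have "(\<Oplus>i\<in>{..n}. add_pow R (n choose i) (x [^] Suc i \<otimes> y [^] (n - i))) \<oplus> ((\<Oplus>i\<in>{..n}. ?t n (Suc i)) \<oplus> ?t n 0)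
      = ((\<Oplus>i\<in>{..n}. add_pow R (n choose i) (x [^] Suc i \<otimes> y [^] (n - i))) \<oplus> (\<Oplus>i\<in>{..n}. ?t n (Suc i))) \<oplus> ?t n 0"
    using x y by (intro a_assoc[symmetric]) auto
  also have "(\<Oplus>i\<in>{..n}. add_pow R (n choose i) (x [^] Suc i \<otimes> y [^] (n - i))) \<oplus> (\<Oplus>i\<in>{..n}. ?t n (Suc i))
     = (\<Oplus>i\<in>{..n}. ?t (Suc n) (Suc i))"
    using x y by (subst finsum_addf[symmetric]) (auto intro!: finsum_cong' simp: add.nat_pow_mult)
  also have "(\<Oplus>i\<in>{..n}. ?t (Suc n) (Suc i)) \<oplus> ?t n 0 = (\<Oplus>i\<in>{..Suc n}. ?t (Suc n) i)"
    using cl by (subst finsum_Suc2) auto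
  finally show ?case .
qed

text \<open>All inner binomial coefficients \<open>p choose i\<close> are divisible by the characteristic.\<close>

lemma frobenius_add:
  assumes p: "Factorial_Ring.prime (p::nat)" and char: "add_pow R (p) \<one> = \<zero>"
    and x: "x \<in> carrier R" and y: "y \<in> carrier R"
  shows "(x \<oplus> y) [^] p = x [^] p \<oplus> y [^] p"
proof -
  have p2: "p \<ge> 2" using p prime_ge_2_nat by blast
  have kill: "add_pow R (m) z = \<zero>" if "p dvd m" "z \<in> carrier R" for m z
  proof -
    from \<open>p dvd m\<close> obtain j where "m = p * j" by blast
    moreover have "add_pow R (p) z = \<zero>"
      using char that(2) add_pow_ldistr[of \<one> z p] by simp
    ultimately show ?thesis using that(2) by (simp add: add.nat_pow_pow[symmetric])
  qed
  have "(x \<oplus> y) [^] p = (\<Oplus>i\<in>{..p}. add_pow R (p choose i) (x [^] i \<otimes> y [^] (p - i)))"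
    by (rule binomial_theorem[OF x y])
  also have "\<dots> = (\<Oplus>i\<in>{0, p}. add_pow R (p choose i) (x [^] i \<otimes> y [^] (p - i)))"
    using x y p kill dvd_choose_prime[of _ p] by (intro add.finprod_mono_neutral_cong_right) auto
  also have "\<dots> = x [^] p \<oplus> y [^] p"
    using x y p2 by (simp add: a_comm)
  finally show ?thesis .
qed

lemma frobenius_pow_add:
  assumes p: "Factorial_Ring.prime (p::nat)" and char: "add_pow R (p) \<one> = \<zero>"
    and x: "x \<in> carrier R" and y: "y \<in> carrier R"
  shows "(x \<oplus> y) [^] (p ^ n) = x [^] (p ^ n) \<oplus> y [^] (p ^ n)"
proof (induction n)
  case (Suc n)
  have "z [^] (p ^ Suc n) = (z [^] (p ^ n)) [^] p" if "z \<in> carrier R" for z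
    using that by (simp add: nat_pow_pow mult.commute)
  then show ?case using Suc x y frobenius_add[OF p char] by simp
qed (use x y in simp)

lemma frobenius_pow_minus:
  assumes p: "Factorial_Ring.prime (p::nat)" and char: "add_pow R p \<one> = \<zero>"
    and x: "x \<in> carrier R"
  shows "(\<ominus> x) [^] (p ^ n) = \<ominus> (x [^] (p ^ n))"
proof -
  have "p ^ n > 0" using p prime_gt_0_nat by simp
  then have "\<zero> = (x \<oplus> \<ominus> x) [^] (p ^ n)" using x by (simp add: r_neg nat_pow_zero)
  also have "\<dots> = x [^] (p ^ n) \<oplus> (\<ominus> x) [^] (p ^ n)"
    using frobenius_pow_add[OF p char] x by simp
  finally show ?thesis using x by (metis a_comm a_inv_closed minus_equality nat_pow_closed)
qed

end

lemma (in field) frobenius_fixed_subfield: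
  assumes p: "Factorial_Ring.prime (p::nat)" and char: "add_pow R p \<one> = \<zero>"
  shows "subfield {x \<in> carrier R. x [^] (p ^ n) = x} R"
proof (rule subfieldI')
  show "subring {x \<in> carrier R. x [^] (p ^ n) = x} R"
    using frobenius_pow_add[OF p char] frobenius_pow_minus[OF p char]
    by (intro subringI) (auto simp: nat_pow_distrib)
  fix k assume k: "k \<in> {x \<in> carrier R. x [^] (p ^ n) = x} - {\<zero>}"
  then have u: "k \<in> Units R" by (simp add: field_Units)
  have "(k \<otimes> inv k) [^] (p ^ n) = \<one>" using u by simp
  then have "k \<otimes> (inv k) [^] (p ^ n) = \<one>" using k u by (simp add: nat_pow_distrib del: Units_r_inv)
  then have "inv k = (inv k) [^] (p ^ n)" using k u by (intro comm_inv_char) auto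
  then show "inv k \<in> {x \<in> carrier R. x [^] (p ^ n) = x}" using k u by simp
qed

lemma (in ring_hom_ring) hom_add_pow_nat:
  "x \<in> carrier R \<Longrightarrow> h (add_pow R (n::nat) x) = add_pow S n (h x)"
  by (induction n) auto

lemma (in domain) linear_factor_closed:
  "a \<in> carrier R \<Longrightarrow> [\<one>, \<ominus> a] \<in> carrier (poly_ring R)"
  unfolding sym[OF univ_poly_carrier] polynomial_def by simp

lemma (in domain) linear_factor_eq:
  assumes "a \<in> carrier R"
  shows "X = [\<one>, \<ominus> a] \<oplus>\<^bsub>poly_ring R\<^esub> poly_of_const a"
  using assms by (auto simp: var_def univ_poly_add poly_of_const_def l_neg)

lemma (in domain) poly_of_const_ring_hom: "ring_hom_ring R (poly_ring R) poly_of_const"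
  using canonical_embedding_ring_hom[OF carrier_is_subring] by simp

text \<open>Over an algebraically closed field \<open>X^q - X\<close> has \<open>q\<close> roots counted with multiplicity, so it
  remains to see that they are simple. If \<open>a\<close> is a root, then with \<open>u = X - a\<close> additivity of the
  Frobenius map, applied in the polynomial ring, gives \<open>X^q - X = u^q - u = u (u^(q-1) - 1)\<close>, and the
  second factor has the value \<open>-1\<close> at \<open>a\<close>.\<close>

lemma (in algebraically_closed) card_frobenius_fixed:
  assumes p: "Factorial_Ring.prime (p::nat)" and char: "add_pow L p \<one> = \<zero>" and n: "n > 0"
  shows "card {x \<in> carrier L. x [^] (p ^ n) = x} = p ^ n"
proof -
  interpret UP: domain "poly_ring L" using univ_poly_is_domain[OF carrier_is_subring] .
  interpret C: ring_hom_ring L "poly_ring L" poly_of_const by (rule poly_of_const_ring_hom)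
  define q where "q = p ^ n"
  have q2: "q \<ge> 2" unfolding q_def 
    using order_trans[OF prime_ge_2_nat[OF p] self_le_power[of p n]] n prime_ge_1_nat[OF p] by simp
  have charUP: "add_pow (poly_ring L) p \<one>\<^bsub>poly_ring L\<^esub> = \<zero>\<^bsub>poly_ring L\<^esub>"
    using C.hom_add_pow_nat[of \<one> p] char by simp
  have X: "X \<in> carrier (poly_ring L)" using var_closed[OF carrier_is_subring] by simp
  define P where "P = X [^]\<^bsub>poly_ring L\<^esub> q \<ominus>\<^bsub>poly_ring L\<^esub> X"
  have P: "P \<in> carrier (poly_ring L)" unfolding P_def using X by simp
  have ev: "eval P x = x [^] q \<ominus> x" if x: "x \<in> carrier L" for x
  proof -
    interpret E: ring_hom_ring "poly_ring L" L "\<lambda>p. eval p x"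
      using eval_ring_hom[OF carrier_is_subring x] .
    show ?thesis unfolding P_def using X x eval_var[OF x] E.hom_nat_pow[OF X, of q] by (simp add: UP.minus_eq minus_eq)
  qed
  have degX: "length X = 2" "length (\<ominus>\<^bsub>poly_ring L\<^esub> X) = 2"
    using univ_poly_a_inv_length[OF carrier_is_subring X] by (simp_all add: var_def)
  have "degree (X [^]\<^bsub>poly_ring L\<^esub> q) = q"
    unfolding unitary_monom_eq_var_pow[OF carrier_is_subring, symmetric] monom_def by simp
  then have degP: "degree P = q"
    unfolding P_def UP.minus_eq univ_poly_add
    using degX X q2 poly_add_degree_eq[OF carrier_is_subring, of "X [^]\<^bsub>poly_ring L\<^esub> q" "\<ominus>\<^bsub>poly_ring L\<^esub> X"]
    by (simp add: univ_poly_carrier)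
  have P0: "P \<noteq> []" using degP q2 by auto
  have root: "is_root P x \<longleftrightarrow> x \<in> carrier L \<and> x [^] q = x" for x
    unfolding is_root_def using P0 ev by auto
  have mult: "alg_mult P a \<le> 1" if "is_root P a" for a
  proof (rule ccontr)
    assume "\<not> alg_mult P a \<le> 1"
    then have m: "2 \<le> alg_mult P a" by simp
    have a: "a \<in> carrier L" "a [^] q = a" using root that by auto
    interpret E: ring_hom_ring "poly_ring L" L "\<lambda>p. eval p a"
      using eval_ring_hom[OF carrier_is_subring a(1)] .
    define u where "u = [\<one>, \<ominus> a]"
    have u: "u \<in> carrier (poly_ring L)" unfolding u_def using linear_factor_closed a(1) .
    have u0: "u \<noteq> \<zero>\<^bsub>poly_ring L\<^esub>" unfolding u_def univ_poly_zero by simp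
    have eu: "eval u a = \<zero>" unfolding u_def using a(1) by (simp add: r_neg)
    define c where "c = poly_of_const a"
    have c: "c \<in> carrier (poly_ring L)" "c [^]\<^bsub>poly_ring L\<^esub> q = c"
      unfolding c_def using a C.hom_nat_pow[of a q] by (simp, metis)
    have "P = (u \<oplus>\<^bsub>poly_ring L\<^esub> c) [^]\<^bsub>poly_ring L\<^esub> q \<ominus>\<^bsub>poly_ring L\<^esub> (u \<oplus>\<^bsub>poly_ring L\<^esub> c)"
      unfolding P_def linear_factor_eq[OF a(1)] u_def c_def ..
    also have "(u \<oplus>\<^bsub>poly_ring L\<^esub> c) [^]\<^bsub>poly_ring L\<^esub> q = u [^]\<^bsub>poly_ring L\<^esub> q \<oplus>\<^bsub>poly_ring L\<^esub> c"
      using UP.frobenius_pow_add[OF p charUP u c(1)] c(2) unfolding q_def by simp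
    also have "u [^]\<^bsub>poly_ring L\<^esub> q = u \<otimes>\<^bsub>poly_ring L\<^esub> u [^]\<^bsub>poly_ring L\<^esub> (q - 1)"
      using UP.nat_pow_Suc2[OF u, of "q - 1"] q2 by simp
    also have "(u \<otimes>\<^bsub>poly_ring L\<^esub> u [^]\<^bsub>poly_ring L\<^esub> (q - 1)) \<oplus>\<^bsub>poly_ring L\<^esub> c \<ominus>\<^bsub>poly_ring L\<^esub> (u \<oplus>\<^bsub>poly_ring L\<^esub> c)
       = u \<otimes>\<^bsub>poly_ring L\<^esub> (u [^]\<^bsub>poly_ring L\<^esub> (q - 1) \<ominus>\<^bsub>poly_ring L\<^esub> \<one>\<^bsub>poly_ring L\<^esub>)"
    proof -
      have "u [^]\<^bsub>poly_ring L\<^esub> (q - 1) \<in> carrier (poly_ring L)" using u by simp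
      then show ?thesis using u c(1) by algebra
    qed
    finally have Pu: "P = u \<otimes>\<^bsub>poly_ring L\<^esub> (u [^]\<^bsub>poly_ring L\<^esub> (q - 1) \<ominus>\<^bsub>poly_ring L\<^esub> \<one>\<^bsub>poly_ring L\<^esub>)" .
    obtain h where h: "h \<in> carrier (poly_ring L)" "P = (u [^]\<^bsub>poly_ring L\<^esub> (2::nat)) \<otimes>\<^bsub>poly_ring L\<^esub> h"
      using le_alg_mult_imp_pdivides[OF a(1) P m] unfolding u_def pdivides_def factor_def by auto
    have "u \<otimes>\<^bsub>poly_ring L\<^esub> (u \<otimes>\<^bsub>poly_ring L\<^esub> h)
      = u \<otimes>\<^bsub>poly_ring L\<^esub> (u [^]\<^bsub>poly_ring L\<^esub> (q - 1) \<ominus>\<^bsub>poly_ring L\<^esub> \<one>\<^bsub>poly_ring L\<^esub>)"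
      using h(1) u unfolding Pu[symmetric] h(2) by (simp add: numeral_2_eq_2 UP.m_assoc)
    then have "u \<otimes>\<^bsub>poly_ring L\<^esub> h = u [^]\<^bsub>poly_ring L\<^esub> (q - 1) \<ominus>\<^bsub>poly_ring L\<^esub> \<one>\<^bsub>poly_ring L\<^esub>"
      using u u0 h(1) by (simp add: UP.m_lcancel)
    then have "eval (u \<otimes>\<^bsub>poly_ring L\<^esub> h) a = eval (u [^]\<^bsub>poly_ring L\<^esub> (q - 1) \<ominus>\<^bsub>poly_ring L\<^esub> \<one>\<^bsub>poly_ring L\<^esub>) a"
      by simp
    moreover have "eval (u \<otimes>\<^bsub>poly_ring L\<^esub> h) a = \<zero>"
      using eu u h(1) E.hom_mult[OF u h(1)] by (simp add: E.hom_closed)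
    moreover have "eval (u [^]\<^bsub>poly_ring L\<^esub> (q - 1) \<ominus>\<^bsub>poly_ring L\<^esub> \<one>\<^bsub>poly_ring L\<^esub>) a = \<zero> \<ominus> \<one>"
      using eu u q2 E.hom_nat_pow[OF u, of "q - 1"] by (simp add: UP.minus_eq minus_eq nat_pow_zero)
    ultimately show False by (metis minus_eq add.inv_eq_1_iff a_inv_closed l_zero one_closed zero_not_one)
  qed
  have roots: "set_mset (roots P) = {x \<in> carrier L. x [^] q = x}"
    using roots_mem_iff_is_root[OF P] root by auto
  have "q = size (roots P)" using roots_over_carrier[OF P] degP unfolding splitted_def by simp
  also have "\<dots> = (\<Sum>x\<in>set_mset (roots P). 1)"
    unfolding size_multiset_overloaded_eq
  proof (rule sum.cong)
    fix x assume x: "x \<in> set_mset (roots P)"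
    then have "count (roots P) x \<le> 1"
      using mult[of x] roots_mem_iff_is_root[OF P] alg_mult_eq_count_roots[OF P] by simp
    then show "count (roots P) x = 1" using x by (metis One_nat_def count_greater_zero_iff le_antisym less_eq_Suc_le)
  qed simp
  finally show ?thesis unfolding roots q_def by simp
qed

text \<open>The type of the field is that of the algebraic closure of \<open>\<int>/p\<close>; it is the same
  for all \<open>q\<close>, while the field is a record over it.\<close>

theorem exists_finite_field:
  assumes "primepow (q::nat)"
  obtains K :: "((int list \<times> nat) multiset \<Rightarrow> int) ring"
  where "field K" "finite (carrier K)" "card (carrier K) = q"
proof -
  obtain p n where p: "Factorial_Ring.prime (p::nat)" and n: "n > 0" and q: "q = p ^ n"
    using assms unfolding primepow_def by blast
  define R where "R = residue_ring (int p)"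
  interpret R: residues_prime p R
    by unfold_locales (use p R_def in auto)
  let ?L = "R.alg_closure"
  interpret L: algebraic_closure ?L "R.indexed_const ` carrier R" by (rule R.alg_closureE(1))
  interpret H: ring_hom_ring R ?L R.indexed_const
    using ring_hom_ringI2[OF R.ring_axioms L.ring_axioms R.alg_closureE(2)] .
  have "add_pow R m \<one>\<^bsub>R\<^esub> = int m mod int p" for m :: nat
    by (induction m) (auto simp: R.res_zero_eq R.res_add_eq R.res_one_eq mod_add_right_eq add.commute)
  then have "add_pow R p \<one>\<^bsub>R\<^esub> = \<zero>\<^bsub>R\<^esub>" by (simp add: R.res_zero_eq)
  then have char: "add_pow ?L p \<one>\<^bsub>?L\<^esub> = \<zero>\<^bsub>?L\<^esub>"
    using H.hom_add_pow_nat[of "\<one>\<^bsub>R\<^esub>" p] by simp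
  let ?F = "{x \<in> carrier ?L. x [^]\<^bsub>?L\<^esub> (p ^ n) = x}"
  have card: "card ?F = q" using L.card_frobenius_fixed[OF p char n] q by simp
  moreover have "q > 0" using q p prime_gt_0_nat by simp
  ultimately have "finite ?F" by (intro card_ge_0_finite) simp
  then show ?thesis
    using that[of "?L\<lparr>carrier := ?F\<rparr>"] L.subfield_iff(2)[OF L.frobenius_fixed_subfield[OF p char]] card by simp
qed

section \<open>Products of linear factors over a finite field\<close>

text \<open>The enumeration identifies the coordinates of \<open>\<int>\<^sup>q\<close> with the elements of the field.\<close>

locale enumerated_field = field R for R (structure) +
  fixes q :: nat and e :: "nat \<Rightarrow> 'a"
  assumes e_bij: "bij_betw e {..<q} (carrier R)"
begin

abbreviation U where "U \<equiv> poly_ring R"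

sublocale U: domain "poly_ring R"
  by (rule univ_poly_is_domain[OF carrier_is_subring])

sublocale const: ring_hom_ring R "poly_ring R" poly_of_const
  by (rule poly_of_const_ring_hom)

lemma e_closed: "i < q \<Longrightarrow> e i \<in> carrier R"
  using e_bij bij_betwE by blast

lemma e_inj: "i < q \<Longrightarrow> j < q \<Longrightarrow> e i = e j \<Longrightarrow> i = j"
  using e_bij by (auto simp: bij_betw_def inj_on_def)

definition lin_fac :: "nat \<Rightarrow> 'a list" where "lin_fac i = [\<one>, \<ominus> e i]"

text \<open>The product \<open>F(u)\<close> of the introduction, restricted to the factors \<open>X - e i\<close> with \<open>i \<in> A\<close>. The
  set \<open>A\<close> will be the set of those \<open>i\<close> for which \<open>X - e i\<close> is a unit modulo the polynomial at
  hand.\<close>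

definition root_prod :: "nat set \<Rightarrow> (nat \<Rightarrow> nat) \<Rightarrow> 'a list" where
  "root_prod A u = (\<Otimes>\<^bsub>U\<^esub>i\<in>A. lin_fac i [^]\<^bsub>U\<^esub> u i)"

lemma lin_fac_closed [simp]: "i < q \<Longrightarrow> lin_fac i \<in> carrier U"
  unfolding lin_fac_def by (intro linear_factor_closed e_closed)

lemma root_prod_closed [simp]: "A \<subseteq> {..<q} \<Longrightarrow> root_prod A u \<in> carrier U"
  unfolding root_prod_def by (intro U.finprod_closed) auto

lemma root_prod_add:
  "A \<subseteq> {..<q} \<Longrightarrow> root_prod A (\<lambda>i. u i + v i) = root_prod A u \<otimes>\<^bsub>U\<^esub> root_prod A v"
  unfolding root_prod_def
  by (subst U.finprod_multf[symmetric]) (auto intro!: U.finprod_cong' simp: U.nat_pow_mult)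

lemma root_prod_cong: "A \<subseteq> {..<q} \<Longrightarrow> (\<And>i. i \<in> A \<Longrightarrow> u i = v i) \<Longrightarrow> root_prod A u = root_prod A v"
  unfolding root_prod_def by (intro U.finprod_cong') auto

lemma root_prod_mono_neutral:
  assumes "A \<subseteq> B" "B \<subseteq> {..<q}" "\<And>i. i \<in> B - A \<Longrightarrow> u i = 0"
  shows "root_prod A u = root_prod B u"
  unfolding root_prod_def
  using assms finite_subset[OF assms(2)] by (intro U.finprod_mono_neutral_cong_left) auto

lemma root_prod_single:
  assumes "i \<in> A" "A \<subseteq> {..<q}"
  shows "root_prod A (\<lambda>j. if j = i then m else 0) = lin_fac i [^]\<^bsub>U\<^esub> m"
proof -
  have "root_prod A (\<lambda>j. if j = i then m else 0) = root_prod {i} (\<lambda>j. if j = i then m else 0)"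
    using assms by (intro root_prod_mono_neutral[symmetric]) auto
  also have "\<dots> = lin_fac i [^]\<^bsub>U\<^esub> m"
    unfolding root_prod_def using assms by (subst U.finprod_insert) auto
  finally show ?thesis .
qed

text \<open>A multiplicative property of such a product only has to be checked on the linear factors that
  occur. Monicity, nonvanishing at a point and cancellability modulo \<open>P\<close> are all of this kind.\<close>

lemma root_prod_induct:
  assumes A: "A \<subseteq> {..<q}"
    and one: "Q \<one>\<^bsub>U\<^esub>"
    and mult: "\<And>p r. p \<in> carrier U \<Longrightarrow> r \<in> carrier U \<Longrightarrow> Q p \<Longrightarrow> Q r \<Longrightarrow> Q (p \<otimes>\<^bsub>U\<^esub> r)"
    and lin: "\<And>i. i \<in> A \<Longrightarrow> u i > 0 \<Longrightarrow> Q (lin_fac i)"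
  shows "Q (root_prod A u)"
proof -
  have fin: "finite A" using A finite_subset by blast
  have pow: "Q (lin_fac i [^]\<^bsub>U\<^esub> (m::nat))" if "i \<in> A" "u i > 0 \<or> m = 0" for i m
    using that(2)
  proof (induction m)
    case (Suc m)
    then show ?case using that(1) A lin mult[of "lin_fac i [^]\<^bsub>U\<^esub> m" "lin_fac i"] by auto
  qed (simp add: one)
  show ?thesis using fin A lin pow
  proof (induction A rule: finite_induct)
    case (insert i A)
    then have "root_prod (insert i A) u = (lin_fac i [^]\<^bsub>U\<^esub> u i) \<otimes>\<^bsub>U\<^esub> root_prod A u"
      unfolding root_prod_def by (intro U.finprod_insert) auto
    moreover have "Q (lin_fac i [^]\<^bsub>U\<^esub> u i)" using insert.prems(3)[of i "u i"] by auto
    moreover have "Q (root_prod A u)" using insert by auto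
    ultimately show ?case using insert.prems mult by auto
  qed (simp add: root_prod_def one)
qed

lemma eval_mult:
  assumes "p \<in> carrier U" "r \<in> carrier U" "a \<in> carrier R"
  shows "eval (p \<otimes>\<^bsub>U\<^esub> r) a = eval p a \<otimes> eval r a"
  using ring_hom_memE(2)[OF eval_is_hom[OF carrier_is_subring assms(3)] assms(1,2)] .

lemma eval_add:
  assumes "p \<in> carrier U" "r \<in> carrier U" "a \<in> carrier R"
  shows "eval (p \<oplus>\<^bsub>U\<^esub> r) a = eval p a \<oplus> eval r a"
  using ring_hom_memE(3)[OF eval_is_hom[OF carrier_is_subring assms(3)] assms(1,2)] .

lemma eval_closed [simp]:
  assumes "p \<in> carrier U" "a \<in> carrier R"
  shows "eval p a \<in> carrier R"
  using ring_hom_memE(1)[OF eval_is_hom[OF carrier_is_subring assms(2)] assms(1)] .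

lemma eval_const [simp]: "c \<in> carrier R \<Longrightarrow> a \<in> carrier R \<Longrightarrow> eval (poly_of_const c) a = c"
  unfolding poly_of_const_def by auto

lemma eval_lin_fac: "i < q \<Longrightarrow> a \<in> carrier R \<Longrightarrow> eval (lin_fac i) a = a \<ominus> e i"
  unfolding lin_fac_def using e_closed[of i] by (simp add: minus_eq)

lemma eval_root_prod_nonzero:
  assumes A: "A \<subseteq> {..<q}" and j: "j < q" and "j \<in> A \<Longrightarrow> u j = 0"
  shows "eval (root_prod A u) (e j) \<noteq> \<zero>"
proof (rule root_prod_induct[OF A, where Q = "\<lambda>p. eval p (e j) \<noteq> \<zero>"])
  show "eval \<one>\<^bsub>U\<^esub> (e j) \<noteq> \<zero>" by (simp add: univ_poly_one)
  show "eval (p \<otimes>\<^bsub>U\<^esub> r) (e j) \<noteq> \<zero>"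
    if "p \<in> carrier U" "r \<in> carrier U" "eval p (e j) \<noteq> \<zero>" "eval r (e j) \<noteq> \<zero>" for p r
    using that e_closed[OF j] by (simp add: eval_mult integral_iff)
  fix i assume i: "i \<in> A" "0 < u i"
  then have "i < q" "i \<noteq> j" using A assms(3) by auto
  then show "eval (lin_fac i) (e j) \<noteq> \<zero>" using j e_inj e_closed by (auto simp: eval_lin_fac)
qed

lemma eval_root_prod_zero:
  assumes A: "A \<subseteq> {..<q}" and j: "j \<in> A" "u j > 0"
  shows "eval (root_prod A u) (e j) = \<zero>"
proof -
  have jq: "j < q" using A j by auto
  have ej: "e j \<in> carrier R" using e_closed[OF jq] .
  have "root_prod A u = root_prod A (\<lambda>i. (if i = j then 1 else 0) + (u i - (if i = j then 1 else 0)))"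
    using j by (intro root_prod_cong[OF A]) auto
  also have "\<dots> = lin_fac j \<otimes>\<^bsub>U\<^esub> root_prod A (\<lambda>i. u i - (if i = j then 1 else 0))"
    using root_prod_add[OF A] root_prod_single[OF j(1) A, of 1] jq by simp
  finally show ?thesis using jq A ej by (simp add: eval_mult eval_lin_fac minus_eq r_neg)
qed

definition monic :: "'a list \<Rightarrow> bool" where
  "monic p \<longleftrightarrow> p \<in> carrier U \<and> p \<noteq> [] \<and> hd p = \<one>"

lemma mult_degree_lead:
  assumes "p \<in> carrier U" "r \<in> carrier U" "p \<noteq> []" "r \<noteq> []"
  shows "degree (p \<otimes>\<^bsub>U\<^esub> r) = degree p + degree r" "hd (p \<otimes>\<^bsub>U\<^esub> r) = hd p \<otimes> hd r" "p \<otimes>\<^bsub>U\<^esub> r \<noteq> []"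
proof -
  show "degree (p \<otimes>\<^bsub>U\<^esub> r) = degree p + degree r"
    using poly_mult_degree_eq[OF carrier_is_subring, of p r] assms by (simp add: univ_poly_carrier univ_poly_mult)
  show "hd (p \<otimes>\<^bsub>U\<^esub> r) = hd p \<otimes> hd r"
    using poly_mult_lead_coeff[OF carrier_is_subring, of p r] assms by (simp add: univ_poly_carrier univ_poly_mult)
  show "p \<otimes>\<^bsub>U\<^esub> r \<noteq> []"
    using U.integral_iff[of p r] assms by (simp add: univ_poly_zero)
qed

lemma monic_root_prod:
  assumes A: "A \<subseteq> {..<q}"
  shows "monic (root_prod A u)"
proof (rule root_prod_induct[OF A, where Q = monic])
  show "monic \<one>\<^bsub>U\<^esub>" 
    using U.one_closed unfolding monic_def univ_poly_one by simp
  show "monic (p \<otimes>\<^bsub>U\<^esub> r)" if "monic p" "monic r" for p r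
    using that mult_degree_lead[of p r] unfolding monic_def by simp
  show "monic (lin_fac i)" if "i \<in> A" for i
    using that A lin_fac_closed[of i] unfolding monic_def by (auto simp: lin_fac_def)
qed

lemma degree_pow_lin_fac:
  assumes "i < q" shows "degree (lin_fac i [^]\<^bsub>U\<^esub> (m::nat)) = m"
  using polynomial_pow_degree[OF lin_fac_closed[OF assms], of m] by (simp add: lin_fac_def[of i])

lemma degree_root_prod:
  assumes A: "A \<subseteq> {..<q}"
  shows "degree (root_prod A u) = (\<Sum>i\<in>A. u i)"
proof -
  have fin: "finite A" using A finite_subset by blast
  show ?thesis using fin A
  proof (induction A rule: finite_induct)
    case (insert i A)
    then have i: "i < q" "A \<subseteq> {..<q}" by auto
    have s: "root_prod (insert i A) u = root_prod {i} u \<otimes>\<^bsub>U\<^esub> root_prod A u"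
      "root_prod {i} u = lin_fac i [^]\<^bsub>U\<^esub> u i"
      unfolding root_prod_def using insert by (subst U.finprod_insert; auto)+
    have "degree (root_prod (insert i A) u) = degree (root_prod {i} u) + degree (root_prod A u)"
      unfolding s(1) using monic_root_prod[of "{i}" u] monic_root_prod[of A u] i
      by (intro mult_degree_lead(1)) (auto simp: monic_def)
    then show ?case using insert i degree_pow_lin_fac unfolding s(2) by simp
  qed (simp add: root_prod_def univ_poly_one)
qed

lemma pdivides_mult:
  assumes "p \<in> carrier U" "r \<in> carrier U" "t \<in> carrier U" "p pdivides r"
  shows "p pdivides (r \<otimes>\<^bsub>U\<^esub> t)" "p pdivides (t \<otimes>\<^bsub>U\<^esub> r)"
  using assms U.divides_prod_r U.m_comm unfolding pdivides_def by metis+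

lemma pdivides_diff:
  assumes "p \<in> carrier U" "r \<in> carrier U" "t \<in> carrier U" "p pdivides r" "p pdivides t"
  shows "p pdivides (r \<ominus>\<^bsub>U\<^esub> t)"
proof -
  obtain x y where "x \<in> carrier U" "y \<in> carrier U" "r = p \<otimes>\<^bsub>U\<^esub> x" "t = p \<otimes>\<^bsub>U\<^esub> y"
    using assms unfolding pdivides_def factor_def by blast
  then have "r \<ominus>\<^bsub>U\<^esub> t = p \<otimes>\<^bsub>U\<^esub> (x \<ominus>\<^bsub>U\<^esub> y)" "x \<ominus>\<^bsub>U\<^esub> y \<in> carrier U"
    using assms(1) by (algebra, simp)
  then show ?thesis unfolding pdivides_def factor_def by blast
qed

text \<open>If \<open>(X - e i) h = P r\<close>, then evaluation at \<open>e i\<close> shows that \<open>e i\<close> is a root of \<open>r\<close>, so that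
  \<open>X - e i\<close> can be removed from \<open>r\<close>.\<close>

lemma pdivides_lin_fac_cancel:
  assumes P: "P \<in> carrier U" and i: "i < q" "eval P (e i) \<noteq> \<zero>" and h: "h \<in> carrier U"
    and dvd: "P pdivides (lin_fac i \<otimes>\<^bsub>U\<^esub> h)"
  shows "P pdivides h"
proof -
  note ei = e_closed[OF i(1)]
  obtain r where r: "r \<in> carrier U" "lin_fac i \<otimes>\<^bsub>U\<^esub> h = P \<otimes>\<^bsub>U\<^esub> r"
    using dvd unfolding pdivides_def factor_def by blast
  have "eval P (e i) \<otimes> eval r (e i) = eval (lin_fac i) (e i) \<otimes> eval h (e i)"
    using r P h ei i(1) eval_mult[of P r] eval_mult[of "lin_fac i" h] by simp
  also have "\<dots> = \<zero>" using i(1) ei h by (simp add: eval_lin_fac minus_eq r_neg)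
  finally have "eval r (e i) = \<zero>" using i(2) P r(1) ei integral_iff by simp
  then have "lin_fac i pdivides r"
    using is_root_imp_pdivides[OF r(1), of "e i"] ei pdivides_zero[OF carrier_is_subring, of "lin_fac i"] lin_fac_closed[OF i(1)]
    unfolding is_root_def lin_fac_def by (cases "r = []") auto
  then obtain s where s: "s \<in> carrier U" "r = lin_fac i \<otimes>\<^bsub>U\<^esub> s"
    unfolding pdivides_def factor_def by blast
  have "lin_fac i \<otimes>\<^bsub>U\<^esub> h = lin_fac i \<otimes>\<^bsub>U\<^esub> (P \<otimes>\<^bsub>U\<^esub> s)"
    unfolding r(2) s(2) using P s(1) i(1) by (simp add: U.m_lcomm)
  moreover have "lin_fac i \<noteq> \<zero>\<^bsub>U\<^esub>" unfolding lin_fac_def univ_poly_zero by simp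
  ultimately have "h = P \<otimes>\<^bsub>U\<^esub> s" using P s(1) i(1) h by (simp add: U.m_lcancel)
  then show ?thesis using s(1) unfolding pdivides_def factor_def by blast
qed

lemma pdivides_root_prod_cancel:
  assumes P: "P \<in> carrier U" and A: "A \<subseteq> {..<q}" "\<And>i. i \<in> A \<Longrightarrow> eval P (e i) \<noteq> \<zero>"
    and h: "h \<in> carrier U" and dvd: "P pdivides (root_prod A u \<otimes>\<^bsub>U\<^esub> h)"
  shows "P pdivides h"
proof -
  have "\<forall>h\<in>carrier U. P pdivides (root_prod A u \<otimes>\<^bsub>U\<^esub> h) \<longrightarrow> P pdivides h"
  proof (rule root_prod_induct[OF A(1)])
    show "\<forall>h\<in>carrier U. P pdivides (lin_fac i \<otimes>\<^bsub>U\<^esub> h) \<longrightarrow> P pdivides h" if "i \<in> A" for i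
      using that A pdivides_lin_fac_cancel[OF P] by blast
    show "\<forall>h\<in>carrier U. P pdivides (p \<otimes>\<^bsub>U\<^esub> r \<otimes>\<^bsub>U\<^esub> h) \<longrightarrow> P pdivides h"
      if p: "p \<in> carrier U" "\<forall>h\<in>carrier U. P pdivides (p \<otimes>\<^bsub>U\<^esub> h) \<longrightarrow> P pdivides h"
        and r: "r \<in> carrier U" "\<forall>h\<in>carrier U. P pdivides (r \<otimes>\<^bsub>U\<^esub> h) \<longrightarrow> P pdivides h" for p r
      using p r U.m_assoc[of p r] U.m_closed[of r] by metis
  qed simp
  then show ?thesis using h dvd by blast
qed

section \<open>The lattice of a modulus\<close>

text \<open>For units modulo \<open>P\<close>: equality of \<open>f\<close> and \<open>g\<close> in the quotient of the unit group of \<open>K[X]/P\<close> by the nonzero constants,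
  without reference to inverses. Two constants instead of one keep the relation visibly symmetric
  and fit the polynomials \<open>c F(A) + (1 - c) F(B)\<close>.\<close>

definition cong_up_to_const :: "'a list \<Rightarrow> 'a list \<Rightarrow> 'a list \<Rightarrow> bool" where
  "cong_up_to_const P f g \<longleftrightarrow> (\<exists>c\<in>carrier R - {\<zero>}. \<exists>d\<in>carrier R - {\<zero>}.
     P pdivides (poly_of_const c \<otimes>\<^bsub>U\<^esub> f \<oplus>\<^bsub>U\<^esub> poly_of_const d \<otimes>\<^bsub>U\<^esub> g))"

lemma cong_up_to_const_if_diff:
  assumes "f \<in> carrier U" "g \<in> carrier U" "P pdivides (f \<ominus>\<^bsub>U\<^esub> g)"
  shows "cong_up_to_const P f g"
proof -
  have "poly_of_const \<one> \<otimes>\<^bsub>U\<^esub> f \<oplus>\<^bsub>U\<^esub> poly_of_const (\<ominus> \<one>) \<otimes>\<^bsub>U\<^esub> g = f \<ominus>\<^bsub>U\<^esub> g"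
    using assms by (simp add: U.minus_eq U.l_minus)
  then show ?thesis unfolding cong_up_to_const_def using assms(3)
    by (intro bexI[of _ \<one>] bexI[of _ "\<ominus> \<one>"]) auto
qed

lemma cong_up_to_const_sym:
  assumes "f \<in> carrier U" "g \<in> carrier U" "cong_up_to_const P f g"
  shows "cong_up_to_const P g f"
  using assms U.a_comm[of "poly_of_const _ \<otimes>\<^bsub>U\<^esub> f" "poly_of_const _ \<otimes>\<^bsub>U\<^esub> g"]
  unfolding cong_up_to_const_def by (metis DiffD1 U.m_closed const.hom_closed)

text \<open>With \<open>s = c f + d g\<close> and \<open>s' = c' f' + d' g'\<close> the combination \<open>c c' (f f') - d d' (g g')\<close> equals
  \<open>s c' f' - d g s'\<close>, which is divisible by \<open>P\<close>.\<close>

lemma cong_up_to_const_mult: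
  assumes P: "P \<in> carrier U" and cl: "f \<in> carrier U" "g \<in> carrier U" "f' \<in> carrier U" "g' \<in> carrier U"
    and "cong_up_to_const P f g" "cong_up_to_const P f' g'"
  shows "cong_up_to_const P (f \<otimes>\<^bsub>U\<^esub> f') (g \<otimes>\<^bsub>U\<^esub> g')"
proof -
  obtain c d c' d' where c: "c \<in> carrier R" "c \<noteq> \<zero>" and d: "d \<in> carrier R" "d \<noteq> \<zero>"
    and c': "c' \<in> carrier R" "c' \<noteq> \<zero>" and d': "d' \<in> carrier R" "d' \<noteq> \<zero>"
    and dv: "P pdivides (poly_of_const c \<otimes>\<^bsub>U\<^esub> f \<oplus>\<^bsub>U\<^esub> poly_of_const d \<otimes>\<^bsub>U\<^esub> g)"
    and dv': "P pdivides (poly_of_const c' \<otimes>\<^bsub>U\<^esub> f' \<oplus>\<^bsub>U\<^esub> poly_of_const d' \<otimes>\<^bsub>U\<^esub> g')"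
    using assms(6,7) unfolding cong_up_to_const_def by blast
  define C D C' D' where "C = poly_of_const c" and "D = poly_of_const d"
    and "C' = poly_of_const c'" and "D' = poly_of_const d'"
  have k: "C \<in> carrier U" "D \<in> carrier U" "C' \<in> carrier U" "D' \<in> carrier U"
    unfolding C_def D_def C'_def D'_def using c d c' d' by auto
  have dv: "P pdivides (C \<otimes>\<^bsub>U\<^esub> f \<oplus>\<^bsub>U\<^esub> D \<otimes>\<^bsub>U\<^esub> g)" "P pdivides (C' \<otimes>\<^bsub>U\<^esub> f' \<oplus>\<^bsub>U\<^esub> D' \<otimes>\<^bsub>U\<^esub> g')"
    using dv dv' unfolding C_def D_def C'_def D'_def by auto
  have "P pdivides ((C \<otimes>\<^bsub>U\<^esub> f \<oplus>\<^bsub>U\<^esub> D \<otimes>\<^bsub>U\<^esub> g) \<otimes>\<^bsub>U\<^esub> (C' \<otimes>\<^bsub>U\<^esub> f')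
      \<ominus>\<^bsub>U\<^esub> (D \<otimes>\<^bsub>U\<^esub> g) \<otimes>\<^bsub>U\<^esub> (C' \<otimes>\<^bsub>U\<^esub> f' \<oplus>\<^bsub>U\<^esub> D' \<otimes>\<^bsub>U\<^esub> g'))"
    using k cl by (intro pdivides_diff[OF P _ _ pdivides_mult(1)[OF P _ _ dv(1)] pdivides_mult(2)[OF P _ _ dv(2)]]) simp_all
  also have "(C \<otimes>\<^bsub>U\<^esub> f \<oplus>\<^bsub>U\<^esub> D \<otimes>\<^bsub>U\<^esub> g) \<otimes>\<^bsub>U\<^esub> (C' \<otimes>\<^bsub>U\<^esub> f')
      \<ominus>\<^bsub>U\<^esub> (D \<otimes>\<^bsub>U\<^esub> g) \<otimes>\<^bsub>U\<^esub> (C' \<otimes>\<^bsub>U\<^esub> f' \<oplus>\<^bsub>U\<^esub> D' \<otimes>\<^bsub>U\<^esub> g')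
     = (C \<otimes>\<^bsub>U\<^esub> C') \<otimes>\<^bsub>U\<^esub> (f \<otimes>\<^bsub>U\<^esub> f') \<oplus>\<^bsub>U\<^esub> (\<ominus>\<^bsub>U\<^esub> (D \<otimes>\<^bsub>U\<^esub> D')) \<otimes>\<^bsub>U\<^esub> (g \<otimes>\<^bsub>U\<^esub> g')"
  proof -
    have "(F \<oplus>\<^bsub>U\<^esub> G) \<otimes>\<^bsub>U\<^esub> F' \<ominus>\<^bsub>U\<^esub> G \<otimes>\<^bsub>U\<^esub> (F' \<oplus>\<^bsub>U\<^esub> G') = F \<otimes>\<^bsub>U\<^esub> F' \<oplus>\<^bsub>U\<^esub> (\<ominus>\<^bsub>U\<^esub> (G \<otimes>\<^bsub>U\<^esub> G'))"
      if "F \<in> carrier U" "G \<in> carrier U" "F' \<in> carrier U" "G' \<in> carrier U" for F G F' G'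
      using that by algebra
    moreover have "(A \<otimes>\<^bsub>U\<^esub> r) \<otimes>\<^bsub>U\<^esub> (B \<otimes>\<^bsub>U\<^esub> s) = (A \<otimes>\<^bsub>U\<^esub> B) \<otimes>\<^bsub>U\<^esub> (r \<otimes>\<^bsub>U\<^esub> s)"
      if "A \<in> carrier U" "B \<in> carrier U" "r \<in> carrier U" "s \<in> carrier U" for A B r s
      using that by (simp add: U.m_ac)
    ultimately show ?thesis using k cl by (simp add: U.l_minus)
  qed
  also have "C \<otimes>\<^bsub>U\<^esub> C' = poly_of_const (c \<otimes> c')"
    unfolding C_def C'_def using c c' by simp
  also have "\<ominus>\<^bsub>U\<^esub> (D \<otimes>\<^bsub>U\<^esub> D') = poly_of_const (\<ominus> (d \<otimes> d'))"
    unfolding D_def D'_def using d d' by simp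
  finally show ?thesis unfolding cong_up_to_const_def
    using c d c' d' integral_iff by (intro bexI[of _ "c \<otimes> c'"] bexI[of _ "\<ominus> (d \<otimes> d')"]) auto
qed

definition nonroots :: "'a list \<Rightarrow> nat set" where
  "nonroots P = {i. i < q \<and> eval P (e i) \<noteq> \<zero>}"

text \<open>The vector \<open>x\<close> may be written as \<open>u - v\<close> in any way, not only with disjoint supports: this makes
  closure under addition immediate, and common factors can be cancelled modulo \<open>P\<close> because they are
  taken over the nonroots of \<open>P\<close>. The divisibility conditions by \<open>2k\<close> replace vanishing, which
  would lower the rank.\<close>

definition kiss_lattice :: "nat \<Rightarrow> 'a list \<Rightarrow> int vec set" where
  "kiss_lattice k P = {x \<in> carrier_vec q.
     int (2 * k) dvd (\<Sum>i<q. x $ i) \<and>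
     (\<forall>i<q. i \<notin> nonroots P \<longrightarrow> int (2 * k) dvd x $ i) \<and>
     (\<exists>u v. (\<forall>i\<in>nonroots P. x $ i = int (u i) - int (v i)) \<and>
        cong_up_to_const P (root_prod (nonroots P) u) (root_prod (nonroots P) v))}"

lemma nonroots_subset: "nonroots P \<subseteq> {..<q}"
  unfolding nonroots_def by auto

lemma nonroots_finite: "finite (nonroots P)"
  using nonroots_subset finite_subset by blast

lemma pdivides_zero_poly: "P \<in> carrier U \<Longrightarrow> P pdivides \<zero>\<^bsub>U\<^esub>"
  using pdivides_zero[OF carrier_is_subring] by (simp add: univ_poly_zero)

lemma int_lattice_kiss_lattice:
  assumes P: "P \<in> carrier U"
  shows "int_lattice q (kiss_lattice k P)"
  unfolding int_lattice_def
proof (rule subgroup.intro)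
  let ?I = "nonroots P"
  show "kiss_lattice k P \<subseteq> carrier (monoid_vec TYPE(int) q)"
    unfolding kiss_lattice_def by (auto simp: monoid_vec_simps)
  have "cong_up_to_const P (root_prod ?I (\<lambda>_. 0)) (root_prod ?I (\<lambda>_. 0))"
    using nonroots_subset pdivides_zero_poly[OF P] by (intro cong_up_to_const_if_diff) (auto simp: U.minus_eq U.r_neg)
  then show "\<one>\<^bsub>monoid_vec TYPE(int) q\<^esub> \<in> kiss_lattice k P"
    using nonroots_subset unfolding kiss_lattice_def
    by (auto simp: monoid_vec_simps subset_iff intro!: exI[of _ "\<lambda>_. 0"])
  show "x \<otimes>\<^bsub>monoid_vec TYPE(int) q\<^esub> y \<in> kiss_lattice k P"
    if x: "x \<in> kiss_lattice k P" and y: "y \<in> kiss_lattice k P" for x y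
  proof -
    obtain u v where u: "\<And>i. i \<in> ?I \<Longrightarrow> x $ i = int (u i) - int (v i)"
      "cong_up_to_const P (root_prod ?I u) (root_prod ?I v)" using x unfolding kiss_lattice_def by blast
    obtain u' v' where u': "\<And>i. i \<in> ?I \<Longrightarrow> y $ i = int (u' i) - int (v' i)"
      "cong_up_to_const P (root_prod ?I u') (root_prod ?I v')" using y unfolding kiss_lattice_def by blast
    have c: "x \<in> carrier_vec q" "y \<in> carrier_vec q" using x y unfolding kiss_lattice_def by auto
    have "cong_up_to_const P (root_prod ?I (\<lambda>i. u i + u' i)) (root_prod ?I (\<lambda>i. v i + v' i))"
      unfolding root_prod_add[OF nonroots_subset]
      using cong_up_to_const_mult[OF P _ _ _ _ u(2) u'(2)] nonroots_subset by simp
    moreover have "(x + y) $ i = int (u i + u' i) - int (v i + v' i)" if "i \<in> ?I" for i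
      using that u(1) u'(1) c nonroots_subset[of P] by auto
    moreover have "(\<Sum>i<q. (x + y) $ i) = (\<Sum>i<q. x $ i) + (\<Sum>i<q. y $ i)"
      unfolding sum.distrib[symmetric] using c by (intro sum.cong) auto
    moreover have "int (2 * k) dvd (x + y) $ i" if "i < q" "i \<notin> ?I" for i
    proof -
      have "int (2 * k) dvd x $ i" "int (2 * k) dvd y $ i"
        using x y that unfolding kiss_lattice_def by blast+
      then show ?thesis using c that(1) by (simp add: dvd_add)
    qed
    moreover have "int (2 * k) dvd (\<Sum>i<q. x $ i) + (\<Sum>i<q. y $ i)"
      using x y unfolding kiss_lattice_def by (intro dvd_add) blast+
    ultimately show ?thesis using c unfolding kiss_lattice_def monoid_vec_simps
      by (intro CollectI conjI exI[of _ "\<lambda>i. u i + u' i"] exI[of _ "\<lambda>i. v i + v' i"]) simp_all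
  qed
  show "inv\<^bsub>monoid_vec TYPE(int) q\<^esub> x \<in> kiss_lattice k P" if x: "x \<in> kiss_lattice k P" for x
  proof -
    obtain u v where u: "\<And>i. i \<in> ?I \<Longrightarrow> x $ i = int (u i) - int (v i)"
      "cong_up_to_const P (root_prod ?I u) (root_prod ?I v)" using x unfolding kiss_lattice_def by blast
    have c: "x \<in> carrier_vec q" using x unfolding kiss_lattice_def by auto
    interpret V: comm_group "monoid_vec TYPE(int) q" by (rule comm_group_vec)
    have inv: "inv\<^bsub>monoid_vec TYPE(int) q\<^esub> x = - x"
      using c by (intro V.inv_equality) (auto simp: monoid_vec_simps)
    have "cong_up_to_const P (root_prod ?I v) (root_prod ?I u)"
      using cong_up_to_const_sym[OF _ _ u(2)] nonroots_subset by simp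
    moreover have "(- x) $ i = int (v i) - int (u i)" if "i \<in> ?I" for i
      using that u(1) c nonroots_subset[of P] by auto
    moreover have "(\<Sum>i<q. (- x) $ i) = - (\<Sum>i<q. x $ i)"
      unfolding sum_negf[symmetric] using c by (intro sum.cong) auto
    moreover have "int (2 * k) dvd (- x) $ i" if "i < q" "i \<notin> ?I" for i
      using x that c unfolding kiss_lattice_def by auto
    moreover have "int (2 * k) dvd - (\<Sum>i<q. x $ i)"
      using x unfolding kiss_lattice_def by simp
    ultimately show ?thesis using c unfolding kiss_lattice_def inv
      by (intro CollectI conjI exI[of _ v] exI[of _ u]) simp_all
  qed
qed

lemma finite_lists_below:
  assumes "finite (carrier R)"
  shows "finite {r \<in> carrier U. length r \<le> m}"
proof (rule finite_subset)
  show "{r \<in> carrier U. length r \<le> m} \<subseteq> {r. set r \<subseteq> carrier R \<and> length r \<le> m}"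
    by (auto simp: polynomial_def univ_poly_carrier[symmetric])
  show "finite {r. set r \<subseteq> carrier R \<and> length r \<le> m}"
    using finite_lists_length_le[OF assms] .
qed

lemma carrier_finite: "finite (carrier R)" "card (carrier R) = q"
  using e_bij bij_betw_finite[OF e_bij] bij_betw_same_card[OF e_bij] by auto

text \<open>There are only finitely many remainders modulo \<open>P\<close>. The factor \<open>N\<close> in the exponents will be \<open>2k\<close>,
  so that the resulting lattice vectors satisfy the divisibility conditions.\<close>

lemma powers_repeat_mod:
  fixes N :: nat
  assumes P: "P \<in> carrier U" "P \<noteq> []" and p: "p \<in> carrier U"
  obtains m m' :: nat where "m < m'" "P pdivides (p [^]\<^bsub>U\<^esub> (N * m') \<ominus>\<^bsub>U\<^esub> p [^]\<^bsub>U\<^esub> (N * m))"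
proof -
  let ?f = "\<lambda>m. (p [^]\<^bsub>U\<^esub> (N * m)) pmod P"
  note sub = carrier_is_subfield
  have "range ?f \<subseteq> {r \<in> carrier U. length r \<le> length P}"
  proof (clarify, intro conjI)
    fix m :: nat
    have c: "p [^]\<^bsub>U\<^esub> (N * m) \<in> carrier U" using p by simp
    show "?f m \<in> carrier U" using long_division_closed(2)[OF sub c P(1)] .
    show "length (?f m) \<le> length P" using pmod_degree[OF sub c P] by (cases "?f m") auto
  qed
  then have "finite (range ?f)" using finite_lists_below carrier_finite(1) finite_subset by blast
  then have "\<not> inj ?f" using finite_imageD infinite_UNIV_nat by blast
  then obtain m m' where "m < m'" "?f m = ?f m'"
    unfolding inj_def by (metis nat_neq_iff)
  then show ?thesis
    using that[of m m'] same_pmod_iff_pdivides[OF sub, of "p [^]\<^bsub>U\<^esub> (N * m')" "p [^]\<^bsub>U\<^esub> (N * m)" P] p P by simp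
qed

text \<open>At a nonroot, two powers of \<open>X - e i\<close> with the same remainder modulo \<open>P\<close> yield a multiple of the
  unit vector; at a root, \<open>2k\<close> times the unit vector satisfies all conditions trivially.\<close>

lemma full_rank_kiss_lattice:
  assumes P: "P \<in> carrier U" "P \<noteq> []" and k: "k > 0"
  shows "full_rank_lattice q (kiss_lattice k P)"
proof (rule full_rank_lattice_if_scaled_unit_vecs[OF int_lattice_kiss_lattice[OF P(1)]])
  fix i assume i: "i < q"
  let ?I = "nonroots P"
  have mem: "int (2 * k * n) \<cdot>\<^sub>v unit_vec q i \<in> kiss_lattice k P"
    if "\<And>j. j \<in> ?I \<Longrightarrow> (if j = i then int (2 * k * n) else 0) = int (u j) - int (v j)"
      "cong_up_to_const P (root_prod ?I u) (root_prod ?I v)" for u v n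
  proof -
    have ix: "(int (2 * k * n) \<cdot>\<^sub>v unit_vec q i) $ j = (if j = i then int (2 * k * n) else 0)" if "j < q" for j
      using that i by simp
    have "(\<Sum>j<q. (int (2 * k * n) \<cdot>\<^sub>v unit_vec q i) $ j) = (\<Sum>j<q. if j = i then int (2 * k * n) else 0)"
      using ix by (intro sum.cong) auto
    also have "\<dots> = int (2 * k * n)" using i by simp
    finally have s: "(\<Sum>j<q. (int (2 * k * n) \<cdot>\<^sub>v unit_vec q i) $ j) = int (2 * k * n)" .
    have "\<forall>j\<in>?I. (int (2 * k * n) \<cdot>\<^sub>v unit_vec q i) $ j = int (u j) - int (v j)"
      using that(1) ix nonroots_subset[of P] by (metis lessThan_iff subsetD)
    moreover have "int (2 * k) dvd (if j = i then int (2 * k * n) else 0)" for j by simp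
    moreover have "int (2 * k * n) \<cdot>\<^sub>v unit_vec q i \<in> carrier_vec q" by simp
    ultimately show ?thesis unfolding kiss_lattice_def
      using s that(2) ix by (intro CollectI conjI exI[of _ u] exI[of _ v]) simp_all
  qed
  show "\<exists>c::int. c \<noteq> 0 \<and> c \<cdot>\<^sub>v unit_vec q i \<in> kiss_lattice k P"
  proof (cases "i \<in> ?I")
    case True
    obtain m m' where m: "m < m'"
      "P pdivides (lin_fac i [^]\<^bsub>U\<^esub> (2 * k * m') \<ominus>\<^bsub>U\<^esub> lin_fac i [^]\<^bsub>U\<^esub> (2 * k * m))"
      using powers_repeat_mod[OF P lin_fac_closed[OF i]] .
    have "int (2 * k * (m' - m)) \<cdot>\<^sub>v unit_vec q i \<in> kiss_lattice k P"
    proof (rule mem)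
      show "cong_up_to_const P (root_prod ?I (\<lambda>j. if j = i then 2 * k * m' else 0)) (root_prod ?I (\<lambda>j. if j = i then 2 * k * m else 0))"
        unfolding root_prod_single[OF True nonroots_subset] using m(2) i by (intro cong_up_to_const_if_diff) auto
    qed (use m(1) in \<open>auto simp: of_nat_diff algebra_simps\<close>)
    then show ?thesis using m(1) k by (intro exI[of _ "int (2 * k * (m' - m))"]) auto
  next
    case False
    have "int (2 * k * 1) \<cdot>\<^sub>v unit_vec q i \<in> kiss_lattice k P"
    proof (rule mem)
      show "cong_up_to_const P (root_prod ?I (\<lambda>_. 0)) (root_prod ?I (\<lambda>_. 0))"
        using nonroots_subset pdivides_zero_poly[OF P(1)] by (intro cong_up_to_const_if_diff) (auto simp: U.minus_eq U.r_neg)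
    qed (use False in auto)
    then show ?thesis using k by (intro exI[of _ "int (2 * k * 1)"]) auto
  qed
qed

lemma length_const_mult:
  assumes "c \<in> carrier R" "c \<noteq> \<zero>" "p \<in> carrier U"
  shows "length (poly_of_const c \<otimes>\<^bsub>U\<^esub> p) = length p"
proof (cases "p = []")
  case True
  then show ?thesis using assms U.r_null[of "poly_of_const c"] const.hom_closed[of c] by (simp add: univ_poly_zero)
next
  case False
  have "poly_of_const c = [c]" using assms by (simp add: poly_of_const_def)
  then show ?thesis
    using mult_degree_lead[of "poly_of_const c" p] assms False const.hom_closed[of c]
    by (metis One_nat_def Suc_pred add.left_neutral diff_Suc_1 length_greater_0_conv list.size(3,4) not_Cons_self2)
qed

text \<open>The key estimate. A vector with nonzero coordinate sum, or with a nonzero entry at a root of \<open>P\<close>,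
  has entries of total absolute value at least \<open>2k\<close> by the divisibility conditions. Otherwise let
  \<open>p\<close> and \<open>m\<close> be the positive and negative parts. After cancelling common factors, \<open>P\<close> divides a
  combination \<open>h = a F(p) + b F(m)\<close>, which does not vanish at the elements where \<open>p > 0\<close>. Its degree
  is at most the common sum of \<open>p\<close> and of \<open>m\<close>, so this sum is at least \<open>k\<close>.\<close>

lemma kiss_lattice_norm_ge:
  assumes P: "P \<in> carrier U" "degree P = k"
    and x: "x \<in> kiss_lattice k P" "x \<noteq> 0\<^sub>v q"
  shows "int (2 * k) \<le> x \<bullet> x"
proof -
  let ?I = "nonroots P"
  have xc: "x \<in> carrier_vec q" using x(1) unfolding kiss_lattice_def by auto
  have norm: "x \<bullet> x = (\<Sum>i<q. (x $ i)\<^sup>2)"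
    using xc unfolding scalar_prod_def by (auto simp: power2_eq_square atLeast0LessThan)
  have abs_le: "\<bar>y\<bar> \<le> y\<^sup>2" for y :: int
    using mult_left_mono[of 1 "\<bar>y\<bar>" "\<bar>y\<bar>"] by (cases "y = 0") (auto simp: power2_eq_square)
  have l1: "(\<Sum>i<q. \<bar>x $ i\<bar>) \<le> x \<bullet> x" unfolding norm by (intro sum_mono abs_le)
  show ?thesis
  proof (cases "(\<Sum>i<q. x $ i) = 0 \<and> (\<forall>i<q. i \<notin> ?I \<longrightarrow> x $ i = 0)")
    case False
    then consider "(\<Sum>i<q. x $ i) \<noteq> 0" | i where "i < q" "i \<notin> ?I" "x $ i \<noteq> 0" by blast
    then have "int (2 * k) \<le> (\<Sum>i<q. \<bar>x $ i\<bar>)"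
    proof cases
      case 1
      moreover have "int (2 * k) dvd (\<Sum>i<q. x $ i)" using x(1) unfolding kiss_lattice_def by blast
      ultimately have "\<bar>int (2 * k)\<bar> \<le> \<bar>\<Sum>i<q. x $ i\<bar>" by (rule dvd_imp_le_int)
      then show ?thesis using sum_abs[of "\<lambda>i. x $ i" "{..<q}"] by linarith
    next
      case 2
      moreover have "int (2 * k) dvd x $ i" using x(1) 2 unfolding kiss_lattice_def by blast
      ultimately have "\<bar>int (2 * k)\<bar> \<le> \<bar>x $ i\<bar>" using dvd_imp_le_int by blast
      moreover have "\<bar>x $ i\<bar> \<le> (\<Sum>i<q. \<bar>x $ i\<bar>)" using 2(1) by (intro member_le_sum) auto
      ultimately show ?thesis by linarith
    qed
    then show ?thesis using l1 by linarith
  next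
    case True
    obtain u v where u: "\<And>i. i \<in> ?I \<Longrightarrow> x $ i = int (u i) - int (v i)"
      "cong_up_to_const P (root_prod ?I u) (root_prod ?I v)" using x(1) unfolding kiss_lattice_def by blast
    define p where "p i = nat (x $ i)" for i
    define m where "m i = nat (- x $ i)" for i
    \<comment> \<open>\<open>d\<close> is the part that the given \<open>u\<close> and \<open>v\<close> have in common.\<close>
    define d where "d i = u i - p i" for i
    have dp: "u i = d i + p i" and dm: "v i = d i + m i" if "i \<in> ?I" for i
      using u(1)[OF that] unfolding d_def p_def m_def by auto
    have fu: "root_prod ?I u = root_prod ?I d \<otimes>\<^bsub>U\<^esub> root_prod ?I p" and fv: "root_prod ?I v = root_prod ?I d \<otimes>\<^bsub>U\<^esub> root_prod ?I m"
      using root_prod_cong[OF nonroots_subset, of P u "\<lambda>i. d i + p i"] dp root_prod_cong[OF nonroots_subset, of P v "\<lambda>i. d i + m i"] dm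
        root_prod_add[OF nonroots_subset] by auto
    obtain a b where a: "a \<in> carrier R" "a \<noteq> \<zero>" and b: "b \<in> carrier R" "b \<noteq> \<zero>"
      and dvd: "P pdivides (poly_of_const a \<otimes>\<^bsub>U\<^esub> root_prod ?I u \<oplus>\<^bsub>U\<^esub> poly_of_const b \<otimes>\<^bsub>U\<^esub> root_prod ?I v)"
      using u(2) unfolding cong_up_to_const_def by blast
    define h where "h = poly_of_const a \<otimes>\<^bsub>U\<^esub> root_prod ?I p \<oplus>\<^bsub>U\<^esub> poly_of_const b \<otimes>\<^bsub>U\<^esub> root_prod ?I m"
    have cl: "root_prod ?I w \<in> carrier U" for w by (simp add: nonroots_subset)
    have h: "h \<in> carrier U" unfolding h_def using a b cl by simp
    have "poly_of_const a \<otimes>\<^bsub>U\<^esub> root_prod ?I u \<oplus>\<^bsub>U\<^esub> poly_of_const b \<otimes>\<^bsub>U\<^esub> root_prod ?I v = root_prod ?I d \<otimes>\<^bsub>U\<^esub> h"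
    proof -
      have "A \<otimes>\<^bsub>U\<^esub> (D \<otimes>\<^bsub>U\<^esub> p) \<oplus>\<^bsub>U\<^esub> B \<otimes>\<^bsub>U\<^esub> (D \<otimes>\<^bsub>U\<^esub> m) = D \<otimes>\<^bsub>U\<^esub> (A \<otimes>\<^bsub>U\<^esub> p \<oplus>\<^bsub>U\<^esub> B \<otimes>\<^bsub>U\<^esub> m)"
        if "A \<in> carrier U" "B \<in> carrier U" "D \<in> carrier U" "p \<in> carrier U" "m \<in> carrier U" for A B D p m
        using that by algebra
      then show ?thesis unfolding fu fv h_def using a b cl by simp
    qed
    then have Ph: "P pdivides h"
      using pdivides_root_prod_cancel[OF P(1) nonroots_subset _ h] dvd unfolding nonroots_def by auto
    have "(\<Sum>i<q. x $ i) = (\<Sum>i\<in>?I. x $ i)"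
      using True nonroots_subset by (intro sum.mono_neutral_right) auto
    then have sum0: "(\<Sum>i\<in>?I. x $ i) = 0" using True by simp
    have "\<exists>i\<in>?I. x $ i > 0"
    proof (rule ccontr)
      assume "\<not> (\<exists>i\<in>?I. x $ i > 0)"
      then have "\<forall>i\<in>?I. - x $ i = 0"
        using sum_nonneg_eq_0_iff[OF nonroots_finite, of P "\<lambda>i. - x $ i"] sum0 by (simp add: sum_negf not_less)
      then have "x = 0\<^sub>v q" using True xc by (intro eq_vecI) auto
      then show False using x(2) by simp
    qed
    then obtain j where j: "j \<in> ?I" "x $ j > 0" by blast
    \<comment> \<open>\<open>F(p)\<close> vanishes at \<open>e j\<close> and \<open>F(m)\<close> does not, so \<open>h\<close> is not the zero polynomial.\<close>
    have jq: "j < q" using j nonroots_subset by auto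
    have "eval h (e j) = b \<otimes> eval (root_prod ?I m) (e j)"
      unfolding h_def using a b cl e_closed[OF jq] eval_root_prod_zero[OF nonroots_subset j(1), of p] j(2)
      by (simp add: eval_add eval_mult p_def)
    moreover have "eval (root_prod ?I m) (e j) \<noteq> \<zero>"
      using eval_root_prod_nonzero[OF nonroots_subset jq, of P m] j unfolding m_def by simp
    ultimately have "eval h (e j) \<noteq> \<zero>"
      using b integral_iff[OF b(1) eval_closed[OF cl e_closed[OF jq]]] by simp
    then have "h \<noteq> []" by auto
    then have "k \<le> degree h"
      using pdivides_imp_degree_le[OF carrier_is_subring P(1) h _ Ph] P(2) by simp
    also have "degree h \<le> max (degree (root_prod ?I p)) (degree (root_prod ?I m))"
      unfolding h_def univ_poly_add
      using poly_add_degree[of "poly_of_const a \<otimes>\<^bsub>U\<^esub> root_prod ?I p" "poly_of_const b \<otimes>\<^bsub>U\<^esub> root_prod ?I m"]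
        length_const_mult[OF a cl] length_const_mult[OF b cl] by simp
    also have "\<dots> = max (\<Sum>i\<in>?I. p i) (\<Sum>i\<in>?I. m i)"
      using degree_root_prod[OF nonroots_subset] by simp
    finally have kle: "k \<le> max (\<Sum>i\<in>?I. p i) (\<Sum>i\<in>?I. m i)" .
    have "x $ i = int (p i) - int (m i)" "\<bar>x $ i\<bar> = int (p i) + int (m i)" for i
      unfolding p_def m_def by auto
    then have "int (\<Sum>i\<in>?I. p i) - int (\<Sum>i\<in>?I. m i) = 0"
      "(\<Sum>i\<in>?I. \<bar>x $ i\<bar>) = int (\<Sum>i\<in>?I. p i) + int (\<Sum>i\<in>?I. m i)"
      using sum0 by (simp_all add: sum_subtractf sum.distrib)
    then have "int (2 * k) \<le> (\<Sum>i\<in>?I. \<bar>x $ i\<bar>)" using kle by linarith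
    also have "\<dots> \<le> (\<Sum>i<q. \<bar>x $ i\<bar>)" using nonroots_subset by (intro sum_mono2) auto
    finally show ?thesis using l1 by linarith
  qed
qed

end

section \<open>Differences of indicators of disjoint sets\<close>

text \<open>The fibres over \<open>M\<close> partition \<open>T\<close>, so some fibre has at least the average size.\<close>

lemma pigeonhole_fibre:
  assumes "finite T" "finite M" "M \<noteq> {}" "f ` T \<subseteq> M"
  obtains y where "y \<in> M" "card T \<le> card M * card {t \<in> T. f t = y}"
proof (rule ccontr)
  note witness = that
  assume none: "\<not> thesis"
  have lt: "card M * card {t \<in> T. f t = y} < card T" if "y \<in> M" for y
    using none witness[OF that] by linarith
  have "card M * card T = card M * (\<Sum>y\<in>M. card {t \<in> T. f t = y})"
    using sum.group[OF assms(1,2,4), of "\<lambda>_. 1::nat"] by simp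
  also have "\<dots> = (\<Sum>y\<in>M. card M * card {t \<in> T. f t = y})" by (rule sum_distrib_left)
  also have "\<dots> < (\<Sum>y\<in>M. card T)" using assms lt by (intro sum_strict_mono) auto
  finally show False by simp
qed

lemma finite_bounded_int_vecs:
  "finite {x \<in> carrier_vec n. \<forall>i<n. \<bar>x $ i\<bar> \<le> (b::int)}"
proof (rule finite_subset)
  show "{x \<in> carrier_vec n. \<forall>i<n. \<bar>x $ i\<bar> \<le> b} \<subseteq> vec_of_list ` {xs. set xs \<subseteq> {-b..b} \<and> length xs = n}"
  proof
    fix x assume x: "x \<in> {x \<in> carrier_vec n. \<forall>i<n. \<bar>x $ i\<bar> \<le> b}"
    then have "set (list_of_vec x) \<subseteq> {-b..b}"
      by (auto simp: in_set_conv_nth abs_le_iff) force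
    then show "x \<in> vec_of_list ` {xs. set xs \<subseteq> {-b..b} \<and> length xs = n}"
      using x by (intro image_eqI[of _ _ "list_of_vec x"]) (auto simp: vec_list)
  qed
  show "finite (vec_of_list ` {xs. set xs \<subseteq> {-b..b} \<and> length xs = n})"
    by (intro finite_imageI finite_lists_length_eq) simp
qed

definition disjoint_pairs :: "nat \<Rightarrow> nat \<Rightarrow> (nat set \<times> nat set) set" where
  "disjoint_pairs q k = (SIGMA A:{A. A \<subseteq> {..<q} \<and> card A = k}. {B. B \<subseteq> {..<q} - A \<and> card B = k})"

lemma card_disjoint_pairs: "card (disjoint_pairs q k) = (q choose k) * ((q - k) choose k)"
proof -
  have "card (disjoint_pairs q k) = (\<Sum>A | A \<subseteq> {..<q} \<and> card A = k. card {B. B \<subseteq> {..<q} - A \<and> card B = k})"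
    unfolding disjoint_pairs_def by (rule card_SigmaI) auto
  also have "\<dots> = (\<Sum>A | A \<subseteq> {..<q} \<and> card A = k. (q - k) choose k)"
  proof (rule sum.cong)
    fix A assume "A \<in> {A. A \<subseteq> {..<q} \<and> card A = k}"
    then have "card ({..<q} - A) = q - k" by (auto simp: card_Diff_subset finite_subset)
    then show "card {B. B \<subseteq> {..<q} - A \<and> card B = k} = (q - k) choose k"
      using n_subsets[of "{..<q} - A" k] by simp
  qed simp
  also have "\<dots> = (q choose k) * ((q - k) choose k)" using n_subsets[of "{..<q}" k] by simp
  finally show ?thesis .
qed

lemma finite_disjoint_pairs: "finite (disjoint_pairs q k)"
  by (rule finite_subset[of _ "Pow {..<q} \<times> Pow {..<q}"]) (auto simp: disjoint_pairs_def)

definition signed_vec :: "nat \<Rightarrow> nat set \<times> nat set \<Rightarrow> int vec" where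
  "signed_vec q = (\<lambda>(A, B). vec q (\<lambda>i. of_bool (i \<in> A) - of_bool (i \<in> B)))"

lemma signed_vec_inj: "inj_on (signed_vec q) (disjoint_pairs q k)"
proof (rule inj_onI, clarify)
  fix A B A' B' assume AB: "(A, B) \<in> disjoint_pairs q k" "(A', B') \<in> disjoint_pairs q k"
    and eq: "signed_vec q (A, B) = signed_vec q (A', B')"
  have sub: "A \<subseteq> {..<q}" "B \<subseteq> {..<q} - A" "A' \<subseteq> {..<q}" "B' \<subseteq> {..<q} - A'"
    using AB unfolding disjoint_pairs_def by auto
  have "(of_bool (i \<in> A) - of_bool (i \<in> B) :: int) = of_bool (i \<in> A') - of_bool (i \<in> B')" if "i < q" for i
    using arg_cong[OF eq, of "\<lambda>x. x $ i"] that unfolding signed_vec_def by simp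
  then have "(i \<in> A \<longleftrightarrow> i \<in> A') \<and> (i \<in> B \<longleftrightarrow> i \<in> B')" if "i < q" for i
    using sub that by (force simp: of_bool_def split: if_splits)
  then show "A = A' \<and> B = B'" using sub by blast
qed

lemma signed_vec_index: "i < q \<Longrightarrow> signed_vec q (A, B) $ i = of_bool (i \<in> A) - of_bool (i \<in> B)"
  unfolding signed_vec_def by simp

lemma signed_vec_norm:
  assumes "(A, B) \<in> disjoint_pairs q k"
  shows "signed_vec q (A, B) \<bullet> signed_vec q (A, B) = int (2 * k)" "(\<Sum>i<q. signed_vec q (A, B) $ i) = 0"
proof -
  have s: "A \<subseteq> {..<q}" "B \<subseteq> {..<q}" "A \<inter> B = {}" "card A = k" "card B = k"
    using assms unfolding disjoint_pairs_def by auto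
  have i: "{..<q} \<inter> A = A" "{..<q} \<inter> B = B" using s by auto
  have "signed_vec q (A, B) \<bullet> signed_vec q (A, B) = (\<Sum>i<q. of_bool (i \<in> A) + of_bool (i \<in> B))"
    unfolding scalar_prod_def atLeast0LessThan using s
    by (intro sum.cong) (auto simp: signed_vec_def of_bool_def)
  also have "\<dots> = int (2 * k)"
    using s i by (simp add: sum.distrib of_bool_def sum.If_cases)
  finally show "signed_vec q (A, B) \<bullet> signed_vec q (A, B) = int (2 * k)" .
  have "(\<Sum>i<q. signed_vec q (A, B) $ i) = (\<Sum>i<q. of_bool (i \<in> A) - of_bool (i \<in> B))"
    by (intro sum.cong) (auto simp: signed_vec_index)
  also have "\<dots> = 0" using s i by (simp add: sum_subtractf of_bool_def sum.If_cases)
  finally show "(\<Sum>i<q. signed_vec q (A, B) $ i) = 0" .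
qed

section \<open>Averaging over the modulus\<close>

context enumerated_field begin

lemma poly_add_same_length:
  assumes "length p = length r" "p \<noteq> []" "hd p \<oplus> hd r \<noteq> \<zero>"
  shows "length (poly_add p r) = length p" "hd (poly_add p r) = hd p \<oplus> hd r"
proof -
  have "r \<noteq> []" using assms by auto
  then have "map2 (\<oplus>) p r = (hd p \<oplus> hd r) # map2 (\<oplus>) (tl p) (tl r)"
    using assms(2) by (cases p; cases r) auto
  then have "poly_add p r = (hd p \<oplus> hd r) # map2 (\<oplus>) (tl p) (tl r)"
    using assms(1,3) by simp
  then show "length (poly_add p r) = length p" "hd (poly_add p r) = hd p \<oplus> hd r"
    using assms(1,2) by (cases r; auto)+
qed

text \<open>The coefficients \<open>c\<close> and \<open>1 - c\<close> add up to \<open>1\<close>, so the combination of two monic polynomials of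
  equal degree is monic of that degree.\<close>

definition mix :: "(nat set \<times> nat set) \<times> 'a \<Rightarrow> 'a list" where
  "mix = (\<lambda>((A, B), c). poly_of_const c \<otimes>\<^bsub>U\<^esub> root_prod A (\<lambda>_. 1) \<oplus>\<^bsub>U\<^esub> poly_of_const (\<one> \<ominus> c) \<otimes>\<^bsub>U\<^esub> root_prod B (\<lambda>_. 1))"

context
  fixes A B k c
  assumes AB: "(A, B) \<in> disjoint_pairs q k" and c: "c \<in> carrier R - {\<zero>, \<one>}"
begin

lemma AB_sub: "A \<subseteq> {..<q}" "B \<subseteq> {..<q}" "A \<inter> B = {}" "card A = k" "card B = k"
  using AB unfolding disjoint_pairs_def by auto

lemma c_coeffs: "c \<in> carrier R" "c \<noteq> \<zero>" "\<one> \<ominus> c \<in> carrier R" "\<one> \<ominus> c \<noteq> \<zero>" "c \<oplus> (\<one> \<ominus> c) = \<one>"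
proof -
  show c': "c \<in> carrier R" "c \<noteq> \<zero>" "\<one> \<ominus> c \<in> carrier R" "\<one> \<ominus> c \<noteq> \<zero>" using c by auto
  show "c \<oplus> (\<one> \<ominus> c) = \<one>" using c' by algebra
qed

lemma mix_closed: "mix ((A, B), c) \<in> carrier U"
  unfolding mix_def using AB_sub c_coeffs by simp

lemma mix_monic: "monic (mix ((A, B), c))" "degree (mix ((A, B), c)) = k"
proof -
  let ?f = "root_prod A (\<lambda>_. 1)" and ?g = "root_prod B (\<lambda>_. 1)"
  have f: "monic ?f" "degree ?f = k" and g: "monic ?g" "degree ?g = k"
    using monic_root_prod degree_root_prod AB_sub by auto
  have lead: "poly_of_const d \<otimes>\<^bsub>U\<^esub> p \<noteq> [] \<and> length (poly_of_const d \<otimes>\<^bsub>U\<^esub> p) = Suc k \<and> hd (poly_of_const d \<otimes>\<^bsub>U\<^esub> p) = d"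
    if "d \<in> carrier R" "d \<noteq> \<zero>" "monic p" "degree p = k" for d p
  proof -
    have "p \<noteq> []" "p \<in> carrier U" "hd p = \<one>" using that(3) unfolding monic_def by auto
    moreover have "poly_of_const d = [d]" using that by (simp add: poly_of_const_def)
    ultimately show ?thesis
      using that length_const_mult[of d p] mult_degree_lead[of "poly_of_const d" p] const.hom_closed[of d]
      by (cases p) auto
  qed
  note lf = lead[OF c_coeffs(1,2) f] and lg = lead[OF c_coeffs(3,4) g]
  have "length (mix ((A, B), c)) = Suc k" "hd (mix ((A, B), c)) = \<one>"
    unfolding mix_def prod.case univ_poly_add
    using poly_add_same_length[of "poly_of_const c \<otimes>\<^bsub>U\<^esub> ?f" "poly_of_const (\<one> \<ominus> c) \<otimes>\<^bsub>U\<^esub> ?g"]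
      lf lg c_coeffs(5) by (simp_all del: poly_add.simps)
  then show "monic (mix ((A, B), c))" "degree (mix ((A, B), c)) = k"
    unfolding monic_def using mix_closed by auto
qed

lemma eval_mix:
  assumes "i < q"
  shows "eval (mix ((A, B), c)) (e i) = c \<otimes> eval (root_prod A (\<lambda>_. 1)) (e i) \<oplus> (\<one> \<ominus> c) \<otimes> eval (root_prod B (\<lambda>_. 1)) (e i)"
  unfolding mix_def using AB_sub c_coeffs e_closed[OF assms] by (simp add: eval_add eval_mult)

text \<open>At an element of \<open>A\<close> the first summand vanishes and the second does not, and conversely on \<open>B\<close>;
  this is where disjointness of \<open>A\<close> and \<open>B\<close> is needed.\<close>

lemma mix_nonroots: "A \<union> B \<subseteq> nonroots (mix ((A, B), c))"
proof
  fix i assume i: "i \<in> A \<union> B"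
  then have iq: "i < q" using AB_sub by auto
  have cl: "eval (root_prod C (\<lambda>_. 1)) (e i) \<in> carrier R" if "C \<subseteq> {..<q}" for C
    using that e_closed[OF iq] by simp
  have "eval (mix ((A, B), c)) (e i) \<noteq> \<zero>"
  proof (cases "i \<in> A")
    case True
    then have "i \<notin> B" using AB_sub by auto
    then have "eval (root_prod B (\<lambda>_. 1)) (e i) \<noteq> \<zero>" using eval_root_prod_nonzero[OF AB_sub(2) iq] by simp
    then show ?thesis unfolding eval_mix[OF iq]
      using eval_root_prod_zero[OF AB_sub(1) True] cl[OF AB_sub(2)] c_coeffs integral_iff by simp
  next
    case False
    then have "i \<in> B" using i by simp
    moreover have "eval (root_prod A (\<lambda>_. 1)) (e i) \<noteq> \<zero>" using eval_root_prod_nonzero[OF AB_sub(1) iq] False by simp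
    ultimately show ?thesis unfolding eval_mix[OF iq]
      using eval_root_prod_zero[OF AB_sub(2)] cl[OF AB_sub(1)] c_coeffs integral_iff by simp
  qed
  then show "i \<in> nonroots (mix ((A, B), c))" unfolding nonroots_def using iq by simp
qed

lemma signed_vec_in_kiss_lattice: "signed_vec q (A, B) \<in> kiss_lattice k (mix ((A, B), c))"
proof -
  let ?I = "nonroots (mix ((A, B), c))"
  have s: "root_prod ?I (\<lambda>i. of_bool (i \<in> C)) = root_prod C (\<lambda>_. 1)" if "C \<subseteq> ?I" for C
  proof -
    have "root_prod C (\<lambda>_. 1) = root_prod C (\<lambda>i. of_bool (i \<in> C))"
      using that nonroots_subset by (intro root_prod_cong) auto
    also have "\<dots> = root_prod ?I (\<lambda>i. of_bool (i \<in> C))"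
      using that nonroots_subset by (intro root_prod_mono_neutral) auto
    finally show ?thesis by simp
  qed
  have "mix ((A, B), c) pdivides mix ((A, B), c)"
    unfolding pdivides_def using U.divides_refl mix_closed by blast
  then have "cong_up_to_const (mix ((A, B), c)) (root_prod ?I (\<lambda>i. of_bool (i \<in> A))) (root_prod ?I (\<lambda>i. of_bool (i \<in> B)))"
    using mix_nonroots s c_coeffs unfolding cong_up_to_const_def mix_def
    by (intro bexI[of _ c] bexI[of _ "\<one> \<ominus> c"]) auto
  moreover have "signed_vec q (A, B) $ i = int (of_bool (i \<in> A)) - int (of_bool (i \<in> B))" if "i \<in> ?I" for i
    using that nonroots_subset by (subst signed_vec_index) auto
  moreover have "signed_vec q (A, B) $ i = 0" if "i < q" "i \<notin> ?I" for i
    using that mix_nonroots by (subst signed_vec_index) auto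
  moreover have "signed_vec q (A, B) \<in> carrier_vec q" unfolding signed_vec_def by simp
  ultimately show ?thesis unfolding kiss_lattice_def using signed_vec_norm(2)[OF AB]
    by (intro CollectI conjI exI[of _ "\<lambda>i. of_bool (i \<in> A)"] exI[of _ "\<lambda>i. of_bool (i \<in> B)"]) simp_all
qed

end

text \<open>At a point of \<open>A\<close> the value is \<open>(1 - c) y\<close>, where \<open>y \<noteq> 0\<close> does not involve \<open>c\<close>. Therefore distinct
  triples with the same polynomial have distinct pairs \<open>(A, B)\<close>, hence distinct lattice vectors.\<close>

lemma mix_determines_const:
  assumes AB: "(A, B) \<in> disjoint_pairs q k" and k: "k > 0"
    and c: "c \<in> carrier R - {\<zero>, \<one>}" "d \<in> carrier R - {\<zero>, \<one>}"
    and eq: "mix ((A, B), c) = mix ((A, B), d)"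
  shows "c = d"
proof -
  note s = AB_sub[OF AB c(1)]
  obtain i where i: "i \<in> A" using s(4) k by fastforce
  then have iq: "i < q" "i \<notin> B" using s by auto
  let ?y = "eval (root_prod B (\<lambda>_. 1)) (e i)"
  have y: "?y \<in> carrier R" "?y \<noteq> \<zero>"
    using s e_closed[OF iq(1)] eval_root_prod_nonzero[OF s(2) iq(1)] iq(2) by auto
  have "eval (mix ((A, B), b)) (e i) = (\<one> \<ominus> b) \<otimes> ?y" if "b \<in> carrier R - {\<zero>, \<one>}" for b
    using eval_mix[OF AB that iq(1)] eval_root_prod_zero[OF s(1) i] that y by simp
  then have "(\<one> \<ominus> c) \<otimes> ?y = (\<one> \<ominus> d) \<otimes> ?y" using eq c by metis
  then have "\<one> \<ominus> c = \<one> \<ominus> d" using y c by (simp add: m_rcancel)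
  then have "\<one> \<ominus> (\<one> \<ominus> c) = \<one> \<ominus> (\<one> \<ominus> d)" by simp
  moreover have "\<one> \<ominus> (\<one> \<ominus> b) = b" if "b \<in> carrier R" for b using that by algebra
  ultimately show ?thesis using c by simp
qed

lemma card_monic: "card {P. monic P \<and> degree P = k} = q ^ k" "finite {P. monic P \<and> degree P = k}"
proof -
  let ?L = "{xs. set xs \<subseteq> carrier R \<and> length xs = k}"
  have eq: "{P. monic P \<and> degree P = k} = (\<lambda>xs. \<one> # xs) ` ?L"
  proof (intro equalityI subsetI)
    fix P assume "P \<in> {P. monic P \<and> degree P = k}"
    then have P: "P \<in> carrier U" "P \<noteq> []" "hd P = \<one>" "length P - 1 = k" unfolding monic_def by auto
    then have "P = \<one> # tl P" "length (tl P) = k" by (cases P; simp)+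
    moreover have "set (tl P) \<subseteq> carrier R"
      using P(1,2) by (cases P) (auto simp: univ_poly_carrier[symmetric] polynomial_def)
    ultimately show "P \<in> (\<lambda>xs. \<one> # xs) ` ?L" by blast
  qed (auto simp: monic_def univ_poly_carrier[symmetric] polynomial_def)
  show "card {P. monic P \<and> degree P = k} = q ^ k"
    unfolding eq using card_lists_length_eq[OF carrier_finite(1)] carrier_finite(2) by (simp add: card_image)
  show "finite {P. monic P \<and> degree P = k}"
    unfolding eq using finite_lists_length_eq[OF carrier_finite(1)] by simp
qed

text \<open>A fibre of the map from triples \<open>(A, B, c)\<close> to monic polynomials of degree \<open>k\<close> has at least average
  size, and it injects into the vectors of squared norm \<open>2k\<close> of the corresponding lattice. The
  fibre is nonempty, so the squared minimum is exactly \<open>2k\<close>.\<close>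

theorem exists_good_modulus:
  assumes k: "k > 0" "2 * k \<le> q" and q: "q \<ge> 3"
  obtains P where "full_rank_lattice q (kiss_lattice k P)"
    "(q choose k) * ((q - k) choose k) * (q - 2) \<le> q ^ k * kissing_number q (kiss_lattice k P)"
proof -
  define T where "T = disjoint_pairs q k \<times> (carrier R - {\<zero>, \<one>})"
  let ?M = "{P. monic P \<and> degree P = k}"
  have cardT: "card T = (q choose k) * ((q - k) choose k) * (q - 2)"
  proof -
    have "card (carrier R - {\<zero>, \<one>}) = q - 2"
      using carrier_finite zero_not_one by (subst card_Diff_subset) auto
    then show ?thesis unfolding T_def by (simp add: card_cartesian_product card_disjoint_pairs)
  qed
  have finT: "finite T" unfolding T_def using finite_disjoint_pairs carrier_finite by simp
  have "(q choose k) * ((q - k) choose k) * (q - 2) > 0"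
    using k q by (simp add: zero_less_binomial_iff)
  then have posT: "card T > 0" unfolding cardT .
  have "mix ` T \<subseteq> ?M" unfolding T_def using mix_monic by auto
  moreover have "?M \<noteq> {}"
  proof
    assume "?M = {}"
    then have "q ^ k = 0" using card_monic(1)[of k] by (metis card.empty)
    then show False using q by simp
  qed
  ultimately obtain P where P: "P \<in> ?M" "card T \<le> card ?M * card {t \<in> T. mix t = P}"
    using pigeonhole_fibre[OF finT card_monic(2)] by blast
  let ?L = "kiss_lattice k P"
  let ?F = "{t \<in> T. mix t = P}"
  have Pc: "P \<in> carrier U" "P \<noteq> []" "degree P = k" using P(1) unfolding monic_def by auto
  have image: "(signed_vec q \<circ> fst) ` ?F \<subseteq> {x \<in> ?L. x \<bullet> x = int (2 * k)}"
    using signed_vec_in_kiss_lattice signed_vec_norm(1) unfolding T_def by fastforce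
  have inj: "inj_on (signed_vec q \<circ> fst) ?F"
  proof (rule comp_inj_on)
    show "inj_on fst ?F"
    proof (rule inj_onI)
      fix s t assume s: "s \<in> ?F" and t: "t \<in> ?F" and eq: "fst s = fst t"
      obtain A B c where sd: "s = ((A, B), c)" by (metis prod.exhaust)
      obtain d where td: "t = ((A, B), d)" using eq sd by (metis fst_conv prod.exhaust)
      have "c = d"
        using s t unfolding sd td T_def by (intro mix_determines_const[OF _ k(1), of A B]) auto
      then show "s = t" unfolding sd td by simp
    qed
    show "inj_on (signed_vec q) (fst ` ?F)"
      by (rule inj_on_subset[OF signed_vec_inj]) (auto simp: T_def)
  qed
  have "?F \<noteq> {}" using P(2) posT by fastforce
  then obtain x where x: "x \<in> ?L" "x \<bullet> x = int (2 * k)" using image by fastforce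
  have min: "lattice_min q ?L = int (2 * k)"
    unfolding lattice_min_def
  proof (rule Least_equality)
    have "x \<noteq> 0\<^sub>v q" using x(2) k(1) by auto
    then show "\<exists>x\<in>?L. x \<noteq> 0\<^sub>v q \<and> int (2 * k) = x \<bullet> x" using x by force
  qed (use kiss_lattice_norm_ge[OF Pc(1,3)] in blast)
  have "finite {x \<in> ?L. x \<bullet> x = int (2 * k)}"
  proof (rule finite_subset[OF _ finite_bounded_int_vecs[of q "int (2 * k)"]], clarify, intro conjI allI impI)
    fix x assume x: "x \<in> ?L" "x \<bullet> x = int (2 * k)"
    show xc: "x \<in> carrier_vec q" using x unfolding kiss_lattice_def by simp
    fix i assume i: "i < q"
    have "\<bar>x $ i\<bar> \<le> x $ i * x $ i"
      using mult_left_mono[of 1 "\<bar>x $ i\<bar>" "\<bar>x $ i\<bar>"] by (cases "x $ i = 0") auto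
    also have "\<dots> \<le> (\<Sum>j<q. x $ j * x $ j)" using i by (intro member_le_sum) auto
    also have "\<dots> = int (2 * k)" using x(2) xc unfolding scalar_prod_def atLeast0LessThan by simp
    finally show "\<bar>x $ i\<bar> \<le> int (2 * k)" .
  qed
  then have "card ?F \<le> kissing_number q ?L"
    unfolding kissing_number_def min using card_inj_on_le[OF inj image] by blast
  then have "card T \<le> q ^ k * kissing_number q ?L"
    using P(2) unfolding card_monic(1) by (meson le_trans mult_le_mono2)
  then show ?thesis
    using that[OF full_rank_kiss_lattice[OF Pc(1,2) k(1)]] unfolding cardT by blast
qed

end

lemma exists_lattice:
  assumes "primepow q" "k > 0" "2 * k \<le> q" "q \<ge> 3"
  shows "\<exists>L. full_rank_lattice q L \<and>
    (q choose k) * ((q - k) choose k) * (q - 2) \<le> q ^ k * kissing_number q L"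
proof -
  obtain K :: "((int list \<times> nat) multiset \<Rightarrow> int) ring"
    where K: "field K" "finite (carrier K)" "card (carrier K) = q"
    using exists_finite_field[OF assms(1)] .
  obtain e where "bij_betw e {..<q} (carrier K)"
    using ex_bij_betw_nat_finite[OF K(2)] K(3) by (auto simp: atLeast0LessThan)
  then interpret enumerated_field K q e
    using K(1) by (simp add: enumerated_field_def enumerated_field_axioms_def)
  show ?thesis using exists_good_modulus[OF assms(2-4)] by metis
qed

section \<open>An upper Stirling bound from Wallis's product\<close>

text \<open>The first-order Pade bound for the logarithm. The quadratic Taylor bound
  \<open>x - x\<^sup>2/2\<close> would be too weak for the monotonicity of the Stirling ratio, whose logarithmic increments are of order \<open>1/n\<^sup>2\<close>.\<close>

lemma ln_one_plus_ge_mediant: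
  fixes x :: real
  assumes "0 \<le> x"
  shows "2 * x / (2 + x) \<le> ln (1 + x)"
proof -
  define f where "f = (\<lambda>x::real. ln (1 + x) - 2 * x / (2 + x))"
  have "f 0 \<le> f x"
  proof (rule DERIV_nonneg_imp_nondecreasing[OF assms])
    fix t :: real assume t: "0 \<le> t" "t \<le> x"
    have "(f has_real_derivative 1 / (1 + t) - (2 * (2 + t) - 2 * t) / ((2 + t) * (2 + t))) (at t)"
      unfolding f_def using t by (auto intro!: derivative_eq_intros)
    moreover have "1 / (1 + t) - (2 * (2 + t) - 2 * t) / ((2 + t) * (2 + t)) = t\<^sup>2 / ((1 + t) * (2 + t)\<^sup>2)"
      using t by (simp add: divide_simps) (simp add: power2_eq_square algebra_simps)
    ultimately have "(f has_real_derivative t\<^sup>2 / ((1 + t) * (2 + t)\<^sup>2)) (at t)" by simp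
    then show "\<exists>y. DERIV f t :> y \<and> y \<ge> 0"
      using t by (intro exI[of _ "t\<^sup>2 / ((1 + t) * (2 + t)\<^sup>2)"]) simp
  qed
  then show ?thesis unfolding f_def by simp
qed

text \<open>Stirling's formula states that this ratio of \<open>n!\<close> to \<open>\<surd>n (n/e)^n\<close> tends to \<open>\<surd>(2\<pi>)\<close>.\<close>

definition stirling_ratio :: "nat \<Rightarrow> real" where
  "stirling_ratio n = fact n * exp (real n) / (sqrt (real n) * real n ^ n)"

lemma stirling_ratio_pos: "n \<ge> 1 \<Longrightarrow> 0 < stirling_ratio n"
  unfolding stirling_ratio_def by simp

lemma stirling_ratio_decreasing:
  assumes "n \<ge> 1"
  shows "stirling_ratio (Suc n) \<le> stirling_ratio n"
proof -
  have ln_ratio: "ln (stirling_ratio m) = ln (fact m) + m - (m + 1 / 2) * ln m" if "m \<ge> 1" for m :: nat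
    using that unfolding stirling_ratio_def
    by (simp add: ln_div ln_mult ln_realpow ln_sqrt algebra_simps)
  have "1 \<le> (n + 1 / 2) * ln (1 + 1 / real n)"
  proof -
    have "2 * (1 / real n) / (2 + 1 / real n) = 1 / (n + 1 / 2)"
      using assms by (simp add: divide_simps) 
    then have "1 / (n + 1 / 2) \<le> ln (1 + 1 / real n)"
      using ln_one_plus_ge_mediant[of "1 / real n"] by simp
    then show ?thesis by (simp add: field_simps add_pos_nonneg)
  qed
  moreover have "ln (1 + 1 / real n) = ln (Suc n) - ln n"
  proof -
    have "1 + 1 / real n = real (Suc n) / real n" using assms by (simp add: field_simps)
    then show ?thesis using assms by (simp only: ln_div[of "real (Suc n)" "real n"]) (simp add: ln_div)
  qed
  moreover have "ln (fact (Suc n) :: real) = ln (Suc n) + ln (fact n)"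
    unfolding fact_Suc of_nat_mult by (subst ln_mult) auto
  ultimately have "ln (stirling_ratio (Suc n)) \<le> ln (stirling_ratio n)"
    using assms by (simp add: ln_ratio algebra_simps)
  then show ?thesis using assms stirling_ratio_pos by simp
qed

lemma wallis_product_eq:
  "(\<Prod>j=1..n. (4 * real j ^ 2) / (4 * real j ^ 2 - 1)) * (2 * real n + 1) =
     (4 ^ n * fact n ^ 2 / fact (2 * n)) ^ 2"
proof (induction n)
  case (Suc n)
  define W where "W = (\<Prod>j=1..n. (4 * real j ^ 2) / (4 * real j ^ 2 - 1))"
  define a where "a = 2 * real n + 1"
  have a: "a > 0" "2 * real (Suc n) + 1 = a + 2" unfolding a_def by auto
  have fac: "4 * real (Suc n) ^ 2 - 1 = a * (a + 2)"
    unfolding a_def by (simp add: power2_eq_square algebra_simps)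
  have split: "(\<Prod>j=1..Suc n. (4 * real j ^ 2) / (4 * real j ^ 2 - 1))
      = W * (4 * real (Suc n) ^ 2 / (4 * real (Suc n) ^ 2 - 1))"
    unfolding W_def by simp
  have "(\<Prod>j=1..Suc n. (4 * real j ^ 2) / (4 * real j ^ 2 - 1)) * (2 * real (Suc n) + 1)
      = W * (4 * real (Suc n) ^ 2 / (a * (a + 2))) * (a + 2)"
    unfolding split fac a(2) ..
  also have "\<dots> = W * a * (4 * real (Suc n) ^ 2 / a ^ 2)"
    using a by (simp add: divide_simps power2_eq_square)
  finally have "(\<Prod>j=1..Suc n. (4 * real j ^ 2) / (4 * real j ^ 2 - 1)) * (2 * real (Suc n) + 1) =
    ((\<Prod>j=1..n. (4 * real j ^ 2) / (4 * real j ^ 2 - 1)) * (2 * real n + 1)) * (4 * real (Suc n) ^ 2 / (2 * real n + 1) ^ 2)"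
    unfolding W_def a_def by simp
  also have "\<dots> = (4 ^ n * fact n ^ 2 / fact (2 * n)) ^ 2 * (4 * real (Suc n) ^ 2 / (2 * real n + 1) ^ 2)"
    using Suc by simp
  also have "\<dots> = (4 ^ Suc n * fact (Suc n) ^ 2 / fact (2 * Suc n)) ^ 2"
  proof -
    have "(fact (2 * Suc n) :: real) = (2 * real (Suc n)) * (2 * real n + 1) * fact (2 * n)"
      by (simp add: algebra_simps)
    moreover have "(fact (Suc n) :: real) = real (Suc n) * fact n" by (rule fact_Suc)
    ultimately have "(4 ^ Suc n * fact (Suc n) ^ 2 / fact (2 * Suc n) :: real)
       = (4 ^ n * fact n ^ 2 / fact (2 * n)) * (4 * real (Suc n) ^ 2 / ((2 * real (Suc n)) * (2 * real n + 1)))"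
      by (simp only: power_Suc power_mult_distrib times_divide_times_eq) (simp add: mult_ac)
    also have "4 * real (Suc n) ^ 2 / ((2 * real (Suc n)) * (2 * real n + 1)) = 2 * real (Suc n) / (2 * real n + 1)"
    proof -
      have "4 * s ^ 2 / ((2 * s) * t) = 2 * s / t" if "s \<noteq> 0" for s t :: real
        using that by (simp add: power2_eq_square)
      then show ?thesis using of_nat_neq_0 by blast
    qed
    finally show ?thesis by (simp only: power_mult_distrib power_divide) simp
  qed
  finally show ?case .
qed simp

text \<open>The powers of \<open>n\<close> and \<open>e\<close> cancel, and what remains is a central binomial coefficient, that is,
  Wallis's product. In the limit it reads \<open>l^4 = 2 \<pi> l^2\<close>.\<close>

lemma stirling_ratio_doubling:
  assumes "n \<ge> 1"
  shows "stirling_ratio n ^ 4 = stirling_ratio (2 * n) ^ 2 *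
    ((\<Prod>j=1..n. (4 * real j ^ 2) / (4 * real j ^ 2 - 1)) * (2 * (2 * real n + 1) / real n))"
proof -
  define N where "N = real n ^ n"
  define E where "E = exp (real n)"
  define F where "F = (fact n :: real)"
  define G where "G = (fact (2 * n) :: real)"
  have nz: "N \<noteq> 0" "E \<noteq> 0" "F \<noteq> 0" "G \<noteq> 0" "real n \<noteq> 0"
    using assms unfolding N_def E_def F_def G_def by auto
  have e2: "exp (2 * real n) = E ^ 2" unfolding E_def by (simp add: exp_double)
  have x2: "(2 * real n) ^ (2 * n) = 4 ^ n * N ^ 2"
    unfolding N_def by (simp add: power_mult_distrib power_mult power2_eq_square)
  have "(stirling_ratio n) ^ 2 = F ^ 2 * E ^ 2 / (n * N ^ 2)"
    unfolding stirling_ratio_def F_def N_def E_def by (simp add: power_divide power_mult_distrib)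
  then have l: "stirling_ratio n ^ 4 = (F ^ 2 * E ^ 2 / (n * N ^ 2)) ^ 2"
    by (metis power_mult mult_2 numeral_Bit0)
  have r: "stirling_ratio (2 * n) ^ 2 = G ^ 2 * (E ^ 2) ^ 2 / (2 * n * (4 ^ n * N ^ 2) ^ 2)"
    unfolding stirling_ratio_def G_def using e2 x2 by (simp add: power_divide power_mult_distrib)
  have w: "(\<Prod>j=1..n. (4 * real j ^ 2) / (4 * real j ^ 2 - 1)) * (2 * (2 * real n + 1) / real n) =
     (4 ^ n * F ^ 2 / G) ^ 2 * (2 / real n)"
  proof -
    have "W * (2 * (2 * real n + 1) / real n) = W * (2 * real n + 1) * (2 / real n)" for W :: real by simp
    then show ?thesis unfolding F_def G_def wallis_product_eq[symmetric] .
  qed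
  show ?thesis unfolding l r w using nz by (simp add: field_simps power2_eq_square)
qed

text \<open>The ratio is decreasing and positive, so it has a limit \<open>l \<ge> 0\<close>, and the doubling identity gives
  \<open>l = 0\<close> or \<open>l\<^sup>2 = 2\<pi>\<close>. Either case yields \<open>l \<le> \<surd>(2\<pi>)\<close>, which is enough for an upper bound on
  \<open>n!\<close>; adding the constant \<open>\<surd>(2\<pi>) - l\<close> produces a bound with the right limit without deciding
  between the two.\<close>

lemma fact_le_stirling:
  obtains S :: "nat \<Rightarrow> real" where "S \<longlonglongrightarrow> sqrt (2 * pi)"
    "\<And>n. n \<ge> 1 \<Longrightarrow> 0 < S n \<and> fact n \<le> S n * (sqrt n * (real n / exp 1) ^ n)"
proof -
  let ?s = "\<lambda>n. stirling_ratio (Suc n)"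
  have "decseq ?s" using stirling_ratio_decreasing by (intro decseq_SucI) simp
  moreover have "\<forall>n. 0 \<le> ?s n" using less_imp_le[OF stirling_ratio_pos[of "Suc _"]] by simp
  ultimately obtain l where l: "?s \<longlonglongrightarrow> l" using decseq_convergent by blast
  then have lim: "stirling_ratio \<longlonglongrightarrow> l" using filterlim_sequentially_Suc by blast
  have l0: "0 \<le> l"
    by (rule LIMSEQ_le_const[OF l]) (use \<open>\<forall>n. 0 \<le> ?s n\<close> in blast)
  have "(\<lambda>n. stirling_ratio n ^ 4) \<longlonglongrightarrow> l ^ 4" by (intro tendsto_intros lim)
  moreover have "(\<lambda>n. stirling_ratio n ^ 4) \<longlonglongrightarrow> l ^ 2 * ((pi / 2) * 4)"
  proof (rule Lim_transform_eventually)
    have "filterlim (\<lambda>n::nat. 2 * n) at_top at_top"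
      by (rule filterlim_subseq) (auto simp: strict_mono_def)
    then have "(\<lambda>n. stirling_ratio (2 * n)) \<longlonglongrightarrow> l" using lim by (rule filterlim_compose[rotated])
    moreover have "(\<lambda>n. 2 * (2 * real n + 1) / real n) \<longlonglongrightarrow> 4" by real_asymp
    ultimately show "(\<lambda>n. stirling_ratio (2 * n) ^ 2 *
       ((\<Prod>j=1..n. (4 * real j ^ 2) / (4 * real j ^ 2 - 1)) * (2 * (2 * real n + 1) / real n))) \<longlonglongrightarrow> l ^ 2 * ((pi / 2) * 4)"
      by (intro tendsto_intros wallis)
    show "\<forall>\<^sub>F n in sequentially. stirling_ratio (2 * n) ^ 2 *
       ((\<Prod>j=1..n. (4 * real j ^ 2) / (4 * real j ^ 2 - 1)) * (2 * (2 * real n + 1) / real n)) = stirling_ratio n ^ 4"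
      using eventually_ge_at_top[of 1] by eventually_elim (use stirling_ratio_doubling in simp)
  qed
  ultimately have "l ^ 4 = l ^ 2 * (2 * pi)" using LIMSEQ_unique by fastforce
  then have "l ^ 2 * (l ^ 2 - 2 * pi) = 0"
    by (simp add: algebra_simps power4_eq_xxxx power2_eq_square)
  then have "l ^ 2 \<le> 2 * pi" by auto
  then have ls: "l \<le> sqrt (2 * pi)" using real_le_rsqrt by blast
  define S where "S n = stirling_ratio n + (sqrt (2 * pi) - l)" for n
  show ?thesis
  proof
    have "S \<longlonglongrightarrow> l + (sqrt (2 * pi) - l)" unfolding S_def by (intro tendsto_intros lim)
    then show "S \<longlonglongrightarrow> sqrt (2 * pi)" by simp
    fix n :: nat assume n: "n \<ge> 1"
    have "fact n = stirling_ratio n * (sqrt n * (real n / exp 1) ^ n)"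
      using n unfolding stirling_ratio_def
      by (simp add: power_divide exp_of_nat_mult[symmetric] field_simps)
    also have "\<dots> \<le> S n * (sqrt n * (real n / exp 1) ^ n)"
      using ls unfolding S_def by (intro mult_right_mono) auto
    finally show "0 < S n \<and> fact n \<le> S n * (sqrt n * (real n / exp 1) ^ n)"
      using stirling_ratio_pos[OF n] ls unfolding S_def by auto
  qed
qed

lemma fact_eq_falling_times_fact:
  "m \<le> q \<Longrightarrow> (fact q :: real) = (\<Prod>i<m. real q - real i) * fact (q - m)"
proof (induction m)
  case (Suc m)
  then have "q - m = Suc (q - Suc m)" by simp
  then have "(fact (q - m) :: real) = (real q - real m) * fact (q - Suc m)"
    using Suc.prems by (simp add: of_nat_diff)
  then show ?case using Suc by simp
qed simp

text \<open>Follows from \<open>ln (1 - x) \<ge> -x - 2x\<^sup>2\<close> with \<open>x = i/q\<close>. For \<open>m\<close> near \<open>2\<surd>q\<close> the main term of the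
  exponent is near \<open>-2\<close> and the error term is of order \<open>1/\<surd>q\<close>.\<close>

lemma falling_ratio_ge:
  fixes q m :: nat
  assumes "0 < q" "2 * m \<le> q"
  shows "exp (- (real m ^ 2 / (2 * q)) - 2 * real m ^ 3 / real q ^ 2) \<le> (\<Prod>i<m. 1 - real i / q)"
  using assms(2)
proof (induction m)
  case (Suc m)
  define x where "x = real m / q"
  have x: "0 \<le> x" "x \<le> 1 / 2" using Suc.prems assms(1) unfolding x_def by (auto simp: field_simps)
  have "- (real (Suc m) ^ 2 / (2 * q)) - 2 * real (Suc m) ^ 3 / real q ^ 2
     \<le> (- (real m ^ 2 / (2 * q)) - 2 * real m ^ 3 / real q ^ 2) + (- x - 2 * x ^ 2)"
  proof -
    have "real m ^ 2 / (2 * q) + x \<le> real (Suc m) ^ 2 / (2 * q)"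
      using assms(1) unfolding x_def by (simp add: field_simps power2_eq_square)
    moreover have "2 * real m ^ 3 / real q ^ 2 + 2 * x ^ 2 = (2 * real m ^ 3 + 2 * real m ^ 2) / real q ^ 2"
      unfolding x_def by (simp add: add_divide_distrib power_divide)
    moreover have "(2 * real m ^ 3 + 2 * real m ^ 2) / real q ^ 2 \<le> 2 * real (Suc m) ^ 3 / real q ^ 2"
      by (intro divide_right_mono) (simp_all add: power3_eq_cube power2_eq_square algebra_simps)
    ultimately show ?thesis by linarith
  qed
  also have "- x - 2 * x ^ 2 \<le> ln (1 - x)" using ln_one_minus_pos_lower_bound[OF x] by simp
  finally have "exp (- (real (Suc m) ^ 2 / (2 * q)) - 2 * real (Suc m) ^ 3 / real q ^ 2)
     \<le> exp ((- (real m ^ 2 / (2 * q)) - 2 * real m ^ 3 / real q ^ 2) + ln (1 - x))" by simp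
  also have "\<dots> = exp (- (real m ^ 2 / (2 * q)) - 2 * real m ^ 3 / real q ^ 2) * (1 - x)"
    using x by (simp add: exp_add)
  also have "\<dots> \<le> (\<Prod>i<m. 1 - real i / q) * (1 - x)"
    using Suc x by (intro mult_right_mono) auto
  finally show ?case by (simp add: x_def)
qed simp

section \<open>Asymptotics of the count\<close>

text \<open>Put \<open>r = \<surd>q = k + d\<close> with \<open>0 \<le> d \<le> 1\<close>. After the estimates of the falling factorial and of \<open>k!\<close>,
  the remaining factor is \<open>(r/k)^(2k) e^(2k) q/k\<close>. Here \<open>(r/k)^(2k) = (1 + d/k)^(2k)\<close> is at least
  \<open>e^(2d - 2/k)\<close>, which makes up for rounding \<open>r\<close> down to \<open>k\<close>, and \<open>q/k \<ge> r\<close>. The bound \<open>q \<ge> 16\<close>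
  ensures \<open>2k \<le> q/2\<close>, as the estimate of the falling factorial requires.\<close>

lemma count_lower_bound:
  fixes S :: "nat \<Rightarrow> real"
  assumes S: "\<And>n. n \<ge> 1 \<Longrightarrow> 0 < S n \<and> fact n \<le> S n * (sqrt n * (real n / exp 1) ^ n)"
    and q: "q \<ge> 16"
  defines "k \<equiv> nat \<lfloor>sqrt (real q)\<rfloor>"
  shows "(1 - 2 / q) * exp (- 2 - 16 / sqrt q) * exp (- 2 / k) / (S k)\<^sup>2 * sqrt q * exp (2 * sqrt q)
    \<le> real ((q choose k) * ((q - k) choose k)) * (real q - 2) / real q ^ k"
proof -
  define r where "r = sqrt (real q)"
  define d where "d = r - k"
  have rr: "r ^ 2 = q" unfolding r_def by simp
  have r4: "r \<ge> 4" unfolding r_def using q real_le_rsqrt[of 4 "real q"] by simp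
  have kr: "real k \<le> r" and rk: "r < k + 1"
    unfolding k_def r_def by (simp, simp) (metis add.commute real_of_int_floor_add_one_gt)
  have d: "0 \<le> d" "d \<le> 1" using kr rk unfolding d_def by auto
  have k1: "k \<ge> 1" using r4 rk by linarith
  have k0: "0 < real k" using k1 by simp
  have "4 * k \<le> q"
  proof -
    have "4 * real k \<le> r * r" using kr r4 by (intro mult_mono) auto
    then have "real (4 * k) \<le> real q" using rr by (simp add: power2_eq_square)
    then show ?thesis by (simp only: of_nat_le_iff)
  qed
  then have kq: "k \<le> q" "2 * k \<le> q" "2 * (2 * k) \<le> q" "k \<le> q - k" by auto
  have q0: "real q > 0" using q by simp

  have fall: "real q ^ (2 * k) * exp (- 2 - 16 / r) \<le> fact q / fact (q - 2 * k)"
  proof -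
    have "real k ^ 2 \<le> q" using kr rr by (metis of_nat_0_le_iff power_mono)
    then have "real (2 * k) ^ 2 / (2 * q) \<le> 2" using q0 by (simp add: field_simps)
    moreover have "2 * real (2 * k) ^ 3 / real q ^ 2 \<le> 16 / r"
    proof -
      have "real k ^ 3 \<le> r ^ 3" using kr by (intro power_mono) auto
      moreover have "real q ^ 2 = r ^ 3 * r" unfolding rr[symmetric] by (simp add: power2_eq_square power3_eq_cube)
      moreover have "2 * real (2 * k) ^ 3 = 16 * real k ^ 3" by (simp add: power_mult_distrib)
      ultimately have "2 * real (2 * k) ^ 3 / real q ^ 2 \<le> 16 * r ^ 3 / (r ^ 3 * r)"
        using r4 by (simp only:) (intro divide_right_mono, auto)
      also have "\<dots> = 16 / r" using r4 by simp
      finally show ?thesis .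
    qed
    ultimately have "exp (- 2 - 16 / r) \<le> exp (- (real (2 * k) ^ 2 / (2 * q)) - 2 * real (2 * k) ^ 3 / real q ^ 2)"
      by simp
    also have "\<dots> \<le> (\<Prod>i<2 * k. 1 - real i / q)" using falling_ratio_ge[OF _ kq(3)] q by fastforce
    finally have "real q ^ (2 * k) * exp (- 2 - 16 / r) \<le> real q ^ (2 * k) * (\<Prod>i<2 * k. 1 - real i / q)"
      by (intro mult_left_mono) auto
    also have "\<dots> = (\<Prod>i<2 * k. real q * (1 - real i / q))"
      by (simp add: prod.distrib)
    also have "\<dots> = (\<Prod>i<2 * k. real q - real i)"
      using q0 by (intro prod.cong) (auto simp: field_simps)
    also have "\<dots> = fact q / fact (q - 2 * k)"
      using fact_eq_falling_times_fact[OF kq(2)] by simp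
    finally show ?thesis .
  qed

  have binom: "real ((q choose k) * ((q - k) choose k)) = fact q / fact (q - 2 * k) / (fact k)\<^sup>2"
    using kq by (simp add: binomial_fact power2_eq_square mult_2)

  have fk: "(fact k :: real)\<^sup>2 \<le> (S k)\<^sup>2 * (k * ((real k)\<^sup>2 / exp 2) ^ k)"
  proof -
    have "(fact k :: real)\<^sup>2 \<le> (S k * (sqrt k * (real k / exp 1) ^ k))\<^sup>2"
      using S[OF k1] by (intro power_mono) auto
    also have "\<dots> = (S k)\<^sup>2 * ((sqrt k)\<^sup>2 * ((real k / exp 1)\<^sup>2) ^ k)"
      by (simp add: power_mult_distrib power_mult[symmetric] mult.commute)
    also have "(real k / exp 1)\<^sup>2 = (real k)\<^sup>2 / exp 2"
      by (simp add: power_divide exp_double[symmetric])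
    finally show ?thesis by simp
  qed

  have main: "sqrt q * exp (2 * r - 2 / k) \<le> q ^ k * (q / (k * ((real k)\<^sup>2 / exp 2) ^ k))"
  proof -
    have "k * (d / k - (d / k)\<^sup>2) \<le> k * ln (1 + d / k)"
      using d k1 by (intro mult_left_mono ln_one_plus_pos_lower_bound) (auto simp: field_simps)
    moreover have "k * (d / k - (d / k)\<^sup>2) = d - d\<^sup>2 / k"
      using k0 by (simp add: field_simps power2_eq_square)
    moreover have "d\<^sup>2 / k \<le> 1 / k" using d k0 by (intro divide_right_mono) (auto simp: power_le_one)
    ultimately have "2 * r - 2 / k \<le> 2 * k + 2 * k * ln (1 + d / k)"
      unfolding d_def by (simp add: algebra_simps)
    also have "1 + d / k = r / k" unfolding d_def using k0 by (simp add: field_simps)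
    finally have "exp (2 * r - 2 / k) \<le> exp (2 * k + 2 * k * ln (r / k))" by simp
    also have "\<dots> = exp 2 ^ k * ((r / k) ^ 2) ^ k"
    proof -
      have "exp (2 * k * ln (r / k)) = (r / k) ^ (2 * k)"
        using k0 r4 exp_of_nat_mult[of "2 * k" "ln (r / k)"] by simp
      moreover have "exp (2 * real k) = exp 2 ^ k"
        by (metis exp_of_nat_mult mult.commute)
      ultimately show ?thesis by (simp add: exp_add power_mult)
    qed
    also have "\<dots> = q ^ k / ((real k)\<^sup>2 / exp 2) ^ k"
      using rr by (simp add: power_divide)
    finally have "exp (2 * r - 2 / k) \<le> q ^ k / ((real k)\<^sup>2 / exp 2) ^ k" .
    moreover have "r \<le> q / k"
    proof -
      have "r * k \<le> r * r" using kr r4 by (intro mult_left_mono) auto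
      then show ?thesis using k0 rr by (simp add: pos_le_divide_eq power2_eq_square)
    qed
    ultimately have "r * exp (2 * r - 2 / k) \<le> (q / k) * (q ^ k / ((real k)\<^sup>2 / exp 2) ^ k)"
      using r4 by (intro mult_mono) auto
    then show ?thesis unfolding r_def by (simp add: field_simps)
  qed

  define D where "D = ((real k)\<^sup>2 / exp 2) ^ k"
  have D: "D > 0" unfolding D_def using k0 by simp
  have Sk: "(S k)\<^sup>2 > 0" using S[OF k1] by simp
  have c: "1 - 2 / q \<ge> 0" using q by simp
  have "(1 - 2 / q) * exp (- 2 - 16 / sqrt q) * exp (- 2 / k) / (S k)\<^sup>2 * sqrt q * exp (2 * sqrt q)
    = (1 - 2 / q) * exp (- 2 - 16 / r) / (S k)\<^sup>2 * (sqrt q * exp (2 * r - 2 / k))"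
    unfolding r_def by (simp add: exp_diff exp_minus field_simps)
  also have "\<dots> \<le> (1 - 2 / q) * exp (- 2 - 16 / r) / (S k)\<^sup>2 * (q ^ k * (q / (k * D)))"
    unfolding D_def using c main by (intro mult_left_mono) auto
  also have "\<dots> = (real q ^ (2 * k) * exp (- 2 - 16 / r)) / ((S k)\<^sup>2 * (k * D)) * (real q - 2) / real q ^ k"
  proof -
    have "(1 - 2 / Q) * E / Y * (N * (Q / Z)) = N\<^sup>2 * E / (Y * Z) * (Q - 2) / N"
      if "Q > 0" "N > 0" "Y > 0" "Z > 0" for Q E N Y Z :: real
      using that by (simp add: divide_simps power2_eq_square)
    from this[of "real q" "real q ^ k" "(S k)\<^sup>2" "k * D" "exp (- 2 - 16 / r)"] show ?thesis
      using q0 Sk D k0 by (simp add: power_mult[symmetric] mult.commute)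
  qed
  also have "\<dots> \<le> (fact q / fact (q - 2 * k)) / (fact k)\<^sup>2 * (real q - 2) / real q ^ k"
    using fall fk q unfolding D_def
    by (intro divide_right_mono mult_right_mono frac_le) (auto intro: order_trans)
  finally show ?thesis unfolding binom .
qed

lemma count_asymptotics:
  obtains g :: "nat \<Rightarrow> real" where "g \<longlonglongrightarrow> 1 / (2 * pi * exp 1 ^ 2)"
    "\<And>q k. q \<ge> 16 \<Longrightarrow> k = nat \<lfloor>sqrt (real q)\<rfloor> \<Longrightarrow> g q * sqrt q * exp (2 * sqrt q)
       \<le> real ((q choose k) * ((q - k) choose k)) * (real q - 2) / real q ^ k"
proof -
  obtain S :: "nat \<Rightarrow> real" where S: "S \<longlonglongrightarrow> sqrt (2 * pi)"
    "\<And>n. n \<ge> 1 \<Longrightarrow> 0 < S n \<and> fact n \<le> S n * (sqrt n * (real n / exp 1) ^ n)"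
    using fact_le_stirling by blast
  define k :: "nat \<Rightarrow> nat" where "k q = nat \<lfloor>sqrt (real q)\<rfloor>" for q
  define g where "g q = (1 - 2 / q) * exp (- 2 - 16 / sqrt q) * exp (- 2 / k q) / (S (k q))\<^sup>2" for q :: nat
  have "filterlim k at_top at_top" unfolding k_def
    by (intro filterlim_compose[OF filterlim_nat_sequentially] filterlim_compose[OF filterlim_floor_sequentially]
       filterlim_compose[OF sqrt_at_top] filterlim_real_sequentially)
  moreover have "(\<lambda>n. exp (- 2 / real n)) \<longlonglongrightarrow> 1" by real_asymp
  ultimately have "(\<lambda>q. S (k q)) \<longlonglongrightarrow> sqrt (2 * pi)" "(\<lambda>q. exp (- 2 / k q)) \<longlonglongrightarrow> 1"
    using filterlim_compose S(1) by blast+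
  moreover have "(\<lambda>q. (1 - 2 / real q) * exp (- 2 - 16 / sqrt q)) \<longlonglongrightarrow> exp (- 2)" by real_asymp
  ultimately have "g \<longlonglongrightarrow> exp (- 2) * 1 / (sqrt (2 * pi))\<^sup>2"
    unfolding g_def by (intro tendsto_intros) auto
  also have "exp (- 2) * 1 / (sqrt (2 * pi))\<^sup>2 = 1 / (2 * pi * exp 1 ^ 2)"
    by (simp add: exp_minus field_simps exp_double[symmetric])
  finally show ?thesis using that count_lower_bound[OF S(2)] unfolding g_def k_def by blast
qed

section \<open>The kissing numbers\<close>

theorem theorem1p1:
  shows "\<exists>L :: nat \<Rightarrow> int vec set.
    (\<forall>q. primepow q \<and> q \<ge> 5 \<longrightarrow> full_rank_lattice q (L q)) \<and>
    (\<exists>\<epsilon> :: nat \<Rightarrow> real. (\<epsilon> \<longlongrightarrow> 0) primepow_at_top \<and>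
      (\<forall>q. primepow q \<and> q \<ge> 5 \<longrightarrow>
        real (kissing_number q (L q))
          \<ge> (1 / (2 * pi * exp 1 ^ 2) + \<epsilon> q) * sqrt (real q) * exp (2 * sqrt (real q)))) \<and>
    (\<forall>\<^sub>F q in primepow_at_top. real (kissing_number q (L q)) \<ge> exp (2 * sqrt (real q)))"
proof -
  define C :: real where "C = 1 / (2 * pi * exp 1 ^ 2)"
  have C: "C > 0" unfolding C_def by simp
  define k :: "nat \<Rightarrow> nat" where "k q = nat \<lfloor>sqrt (real q)\<rfloor>" for q
  have k: "k q > 0" "2 * k q \<le> q" if "q \<ge> 5" for q
  proof -
    have s: "sqrt (real q) \<ge> 2" using that real_le_rsqrt[of 2 "real q"] by simp
    then show "k q > 0" unfolding k_def by linarith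
    have "real (2 * k q) \<le> 2 * sqrt (real q)" using s unfolding k_def by simp
    also have "\<dots> \<le> sqrt (real q) * sqrt (real q)" using s by (intro mult_right_mono) auto
    finally show "2 * k q \<le> q" by simp
  qed
  obtain L where L: "\<And>q. primepow q \<and> q \<ge> 5 \<Longrightarrow> full_rank_lattice q (L q) \<and>
    (q choose k q) * ((q - k q) choose k q) * (q - 2) \<le> q ^ k q * kissing_number q (L q)"
  proof -
    have "\<exists>L. primepow q \<and> q \<ge> 5 \<longrightarrow> full_rank_lattice q L \<and>
      (q choose k q) * ((q - k q) choose k q) * (q - 2) \<le> q ^ k q * kissing_number q L" for q
      using exists_lattice[of q "k q"] k[of q] by (cases "primepow q \<and> q \<ge> 5") auto
    then show thesis using that by metis
  qed
  obtain g :: "nat \<Rightarrow> real" where g: "g \<longlonglongrightarrow> C"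
    "\<And>q k. q \<ge> 16 \<Longrightarrow> k = nat \<lfloor>sqrt (real q)\<rfloor> \<Longrightarrow> g q * sqrt q * exp (2 * sqrt q)
       \<le> real ((q choose k) * ((q - k) choose k)) * (real q - 2) / real q ^ k"
    using count_asymptotics unfolding C_def by blast
  have kiss: "g q * sqrt q * exp (2 * sqrt q) \<le> real (kissing_number q (L q))"
    if "primepow q" "q \<ge> 16" for q
  proof -
    have "real ((q choose k q) * ((q - k q) choose k q)) * (real q - 2)
       = real ((q choose k q) * ((q - k q) choose k q) * (q - 2))"
      using that(2) by (simp add: of_nat_diff)
    also have "\<dots> \<le> real (q ^ k q * kissing_number q (L q))"
      using L[of q] that by (intro of_nat_mono) simp
    finally have "real ((q choose k q) * ((q - k q) choose k q)) * (real q - 2) / real q ^ k q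
       \<le> real (kissing_number q (L q))"
      using that(2) by (simp add: divide_le_eq mult.commute)
    then show ?thesis using g(2)[OF that(2), of "k q"] unfolding k_def by linarith
  qed
  \<comment> \<open>The estimate starts at \<open>q = 16\<close>; for smaller \<open>q\<close> the value \<open>- C\<close> makes the claim trivial.\<close>
  define \<epsilon> where "\<epsilon> q = (if q \<ge> 16 then g q - C else - C)" for q
  have "(\<lambda>q. g q - C) \<longlonglongrightarrow> 0" using g(1) by (simp add: LIM_zero_iff)
  then have "\<epsilon> \<longlonglongrightarrow> 0"
    by (rule Lim_transform_eventually) (use eventually_ge_at_top[of 16] in eventually_elim, simp add: \<epsilon>_def)
  then have eps: "(\<epsilon> \<longlongrightarrow> 0) primepow_at_top"
    unfolding primepow_at_top_def by (rule tendsto_mono[rotated]) simp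
  have bound: "(C + \<epsilon> q) * sqrt q * exp (2 * sqrt q) \<le> real (kissing_number q (L q))" if "primepow q" "q \<ge> 5" for q
    using kiss[OF that(1)] unfolding \<epsilon>_def by auto
  have large: "\<forall>\<^sub>F q in primepow_at_top. exp (2 * sqrt q) \<le> real (kissing_number q (L q))"
  proof -
    have "\<forall>\<^sub>F q in sequentially. g q > C / 2" using order_tendstoD(1)[OF g(1), of "C / 2"] C by simp
    moreover have "\<forall>\<^sub>F q::nat in sequentially. sqrt q \<ge> 2 / C"
      using filterlim_compose[OF sqrt_at_top filterlim_real_sequentially] by (simp add: filterlim_at_top)
    ultimately have "\<forall>\<^sub>F q in sequentially. primepow q \<longrightarrow> exp (2 * sqrt q) \<le> real (kissing_number q (L q))"
      using eventually_ge_at_top[of 16]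
    proof eventually_elim
      case (elim q)
      have "1 = C / 2 * (2 / C)" using C by simp
      also have "\<dots> \<le> g q * sqrt q" using elim C by (intro mult_mono) auto
      finally have "exp (2 * sqrt q) \<le> g q * sqrt q * exp (2 * sqrt q)" by simp
      then show ?case using kiss[of q] elim(3) by (blast intro: order_trans)
    qed
    then show ?thesis unfolding primepow_at_top_def eventually_inf_principal by simp
  qed
  show ?thesis using L eps bound large unfolding C_def by blast
qed

end
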